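(* (1) The ring automorphisms $T'_i$ ($i\in I$) of $\mathcal{Y}'$ defined below satisfy the braid relations of $\mathfrak{g}$, hence generate an action of the braid group of $\mathfrak{g}$ on $\mathcal{Y}'$. (2) For every $i\in I$, the restriction of $T'_i$ to $\mathcal{Y}\subset\mathcal{Y}'$ is the Chari operator $T_i$.
   Context: Notation: $\mathfrak{g}$ simple finite-dimensional over $\mathbb{C}$, index set $I$, Cartan matrix $C$, symmetrizers $d_i$, weight lattice $P$ with fundamental weights $\omega_i$, simple roots $\alpha_i=\sum_jC_{j,i}\omega_j$, Weyl group $W$ acting on $P$ by $s_k(\omega_j)=\omega_j-\delta_{kj}\alpha_j$. Fix $q\in\mathbb{C}^\times$ not a root of unity with a chosen logarithm, $q_i=q^{d_i}$. An $\ell$-weight is an $I$-tuple $(\Psi_i(z))_{i\in I}$ of formal power series with $\Psi_i(0)\in q^{\mathbb{Q}}$; they form a group under componentwise multiplication. Let $\mathbf{\Psi}_{i,a}$ be the $\ell$-weight with $j$-th component $(1-za)^{\delta_{i,j}}$, and for $\lambda=\sum_jr_j\omega_j\in P$ let $[\lambda]$ be the constant $\ell$-weight with $j$-th component $q_j^{r_j}$. Let $\mathcal{Y}'=\mathbb{Z}[\mathbf{\Psi}_{i,a}^{\pm1},[\omega_j]^{\pm1}]_{i,j\in I,a\in\mathbb{C}^\times}$ (the group ring of the subgroup of $\ell$-weights they generate). The ring $\mathcal{Y}=\mathbb{Z}[Y_{i,a}^{\pm1}]$ embeds in $\mathcal{Y}'$ via $Y_{i,a}\mapsto[\omega_i]\mathbf{\Psi}_{i,aq_i^{-1}}\mathbf{\Psi}_{i,aq_i}^{-1}$.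 Put $A_{i,a}=Y_{i,aq_i^{-1}}Y_{i,aq_i}\big(\prod_{C_{j,i}=-1}Y_{j,a}\prod_{C_{j,i}=-2}Y_{j,aq^{-1}}Y_{j,aq}\prod_{C_{j,i}=-3}Y_{j,aq^{-2}}Y_{j,a}Y_{j,aq^2}\big)^{-1}$; the Chari operator $T_i$ is the ring automorphism of $\mathcal{Y}$ with $T_i(Y_{i,a})=Y_{i,a}A_{i,aq_i}^{-1}$, $T_i(Y_{j,a})=Y_{j,a}$ ($j\neq i$). Define ring automorphisms $T'_i$ of $\mathcal{Y}'$ by $T'_i([\omega])=[s_i(\omega)]$ for $\omega\in P$, $T'_i(\mathbf{\Psi}_{j,a})=\mathbf{\Psi}_{j,a}$ for $j\ne i$, and $$T'_i(\mathbf{\Psi}_{i,a})=\mathbf{\Psi}_{i,aq_i^2}^{-1}\prod_{j:C_{i,j}=-1}\mathbf{\Psi}_{j,aq_i}\prod_{j:C_{i,j}=-2}\mathbf{\Psi}_{j,a}\mathbf{\Psi}_{j,aq^2}\prod_{j:C_{i,j}=-3}\mathbf{\Psi}_{j,aq^{-1}}\mathbf{\Psi}_{j,aq}\mathbf{\Psi}_{j,aq^3}.$$ *)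

theory Defs
  imports "HOL-Library.Poly_Mapping" "HOL-Computational_Algebra.Formal_Power_Series"
begin

text \<open>The index set I is a finite type 'i.  C is the Cartan matrix (convention
  alpha_i = sum_j C j i omega_j), d the standard symmetrizers (positive integers,
  d i * C i j = d j * C j i, normalised so that the smallest one is 1).
  Simple finite-dimensional g corresponds to C indecomposable of finite type
  (symmetrized matrix positive definite).\<close>

definition cartan_simple :: "('i::finite \<Rightarrow> 'i \<Rightarrow> int) \<Rightarrow> ('i \<Rightarrow> int) \<Rightarrow> bool" where
  "cartan_simple C d \<longleftrightarrow>
     (\<forall>i. C i i = 2) \<and>
     (\<forall>i j. i \<noteq> j \<longrightarrow> C i j \<le> 0) \<and>
     (\<forall>i j. C i j = 0 \<longleftrightarrow> C j i = 0) \<and>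
     (\<forall>i. d i > 0) \<and>
     (\<forall>i j. d i * C i j = d j * C j i) \<and>
     (\<exists>i. d i = 1) \<and>
     (\<forall>x::'i \<Rightarrow> real. x \<noteq> (\<lambda>_. 0) \<longrightarrow>
         (\<Sum>i\<in>UNIV. \<Sum>j\<in>UNIV. x i * of_int (d i * C i j) * x j) > 0) \<and>
     (\<forall>S::'i set. S \<noteq> {} \<and> S \<noteq> UNIV \<longrightarrow> (\<exists>i\<in>S. \<exists>j. j \<notin> S \<and> C i j \<noteq> 0))"

definition braid_m :: "('i \<Rightarrow> 'i \<Rightarrow> int) \<Rightarrow> 'i \<Rightarrow> 'i \<Rightarrow> nat" where
  "braid_m C i j = (if C i j * C j i = 0 then 2 else if C i j * C j i = 1 then 3
                    else if C i j * C j i = 2 then 4 else 6)"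

fun alt :: "('a \<Rightarrow> 'a) \<Rightarrow> ('a \<Rightarrow> 'a) \<Rightarrow> nat \<Rightarrow> 'a \<Rightarrow> 'a" where
  "alt f g 0 = id"
| "alt f g (Suc n) = f \<circ> alt g f n"

text \<open>Simple reflection on P, weights written in the basis of fundamental weights:
  s_i(lambda) = lambda - lambda_i alpha_i, (alpha_i)_l = C l i.\<close>
definition srefl :: "('i \<Rightarrow> 'i \<Rightarrow> int) \<Rightarrow> 'i \<Rightarrow> ('i \<Rightarrow> int) \<Rightarrow> ('i \<Rightarrow> int)" where
  "srefl C i lam = (\<lambda>l. lam l - lam i * C l i)"

type_synonym 'i lweight = "'i \<Rightarrow> complex fps"

definition lwmul :: "'i lweight \<Rightarrow> 'i lweight \<Rightarrow> 'i lweight" where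
  "lwmul x y = (\<lambda>j. x j * y j)"

definition lw1 :: "'i lweight" where
  "lw1 = (\<lambda>j. 1)"

definition lin :: "complex \<Rightarrow> complex fps" where
  "lin a = 1 - fps_const a * fps_X"

definition Psi :: "'i \<Rightarrow> complex \<Rightarrow> 'i lweight" where
  "Psi i a = (\<lambda>j. if j = i then lin a else 1)"

definition Psi_inv :: "'i \<Rightarrow> complex \<Rightarrow> 'i lweight" where
  "Psi_inv i a = (\<lambda>j. if j = i then inverse (lin a) else 1)"

text \<open>[lambda]: constant l-weight, j-th component q_j^{lambda_j} = q^{d_j lambda_j}.\<close>
definition cw :: "complex \<Rightarrow> ('i \<Rightarrow> int) \<Rightarrow> ('i \<Rightarrow> int) \<Rightarrow> 'i lweight" where
  "cw q d lam = (\<lambda>j. fps_const (q powi (d j * lam j)))"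

text \<open>The subgroup of l-weights generated by the Psi_{i,a}^{+-1} (a nonzero) and the
  [omega_j]^{+-1} (equivalently all [lambda], lambda in P).\<close>
inductive_set lwgroup :: "complex \<Rightarrow> ('i \<Rightarrow> int) \<Rightarrow> 'i lweight set" for q d where
  one: "lw1 \<in> lwgroup q d"
| psi: "a \<noteq> 0 \<Longrightarrow> Psi i a \<in> lwgroup q d"
| psi_inv: "a \<noteq> 0 \<Longrightarrow> Psi_inv i a \<in> lwgroup q d"
| cw: "cw q d lam \<in> lwgroup q d"
| mul: "x \<in> lwgroup q d \<Longrightarrow> y \<in> lwgroup q d \<Longrightarrow> lwmul x y \<in> lwgroup q d"

definition Yp :: "complex \<Rightarrow> ('i \<Rightarrow> int) \<Rightarrow> ('i lweight \<Rightarrow>\<^sub>0 int) set" where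
  "Yp q d = {f. Poly_Mapping.keys f \<subseteq> lwgroup q d}"

definition conv :: "('i lweight \<Rightarrow>\<^sub>0 int) \<Rightarrow> ('i lweight \<Rightarrow>\<^sub>0 int) \<Rightarrow> ('i lweight \<Rightarrow>\<^sub>0 int)" where
  "conv f g = (\<Sum>x\<in>Poly_Mapping.keys f. \<Sum>y\<in>Poly_Mapping.keys g. Poly_Mapping.single (lwmul x y) (Poly_Mapping.lookup f x * Poly_Mapping.lookup g y))"

definition gel :: "'i lweight \<Rightarrow> ('i lweight \<Rightarrow>\<^sub>0 int)" where
  "gel x = Poly_Mapping.single x 1"

definition ring_aut_Yp :: "complex \<Rightarrow> ('i \<Rightarrow> int)
    \<Rightarrow> (('i lweight \<Rightarrow>\<^sub>0 int) \<Rightarrow> ('i lweight \<Rightarrow>\<^sub>0 int)) \<Rightarrow> bool" where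
  "ring_aut_Yp q d t \<longleftrightarrow>
     bij_betw t (Yp q d) (Yp q d) \<and>
     (\<forall>f\<in>Yp q d. \<forall>g\<in>Yp q d. t (f + g) = t f + t g \<and> t (conv f g) = conv (t f) (t g)) \<and>
     t (gel lw1) = gel lw1"

definition TPsi_rhs :: "complex \<Rightarrow> ('i \<Rightarrow> 'i \<Rightarrow> int) \<Rightarrow> ('i \<Rightarrow> int) \<Rightarrow> 'i \<Rightarrow> complex \<Rightarrow> 'i lweight" where
  "TPsi_rhs q C d i a = (\<lambda>k.
     if k = i then inverse (lin (a * (q powi d i)\<^sup>2))
     else if C i k = -1 then lin (a * q powi d i)
     else if C i k = -2 then lin a * lin (a * q\<^sup>2)
     else if C i k = -3 then lin (a * inverse q) * lin (a * q) * lin (a * q ^ 3)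
     else 1)"

definition is_Tprime :: "complex \<Rightarrow> ('i \<Rightarrow> 'i \<Rightarrow> int) \<Rightarrow> ('i \<Rightarrow> int) \<Rightarrow> 'i
    \<Rightarrow> (('i lweight \<Rightarrow>\<^sub>0 int) \<Rightarrow> ('i lweight \<Rightarrow>\<^sub>0 int)) \<Rightarrow> bool" where
  "is_Tprime q C d i t \<longleftrightarrow>
     ring_aut_Yp q d t \<and>
     (\<forall>lam. t (gel (cw q d lam)) = gel (cw q d (srefl C i lam))) \<and>
     (\<forall>j a. j \<noteq> i \<and> a \<noteq> 0 \<longrightarrow> t (gel (Psi j a)) = gel (Psi j a)) \<and>
     (\<forall>a. a \<noteq> 0 \<longrightarrow> t (gel (Psi i a)) = gel (TPsi_rhs q C d i a))"

text \<open>Laurent monomials are exponent vectors m : I x C^x =>0 int;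
  Y is the set of finite Z-combinations of monomials in variables with a nonzero.\<close>
type_synonym 'i ymon = "('i \<times> complex) \<Rightarrow>\<^sub>0 int"

definition Ycar :: "('i ymon \<Rightarrow>\<^sub>0 int) set" where
  "Ycar = {f. \<forall>m\<in>Poly_Mapping.keys f. \<forall>k\<in>Poly_Mapping.keys m. snd k \<noteq> 0}"

definition Yv :: "'i \<Rightarrow> complex \<Rightarrow> 'i ymon" where
  "Yv j a = Poly_Mapping.single (j, a) 1"

definition Aexp :: "complex \<Rightarrow> ('i::finite \<Rightarrow> 'i \<Rightarrow> int) \<Rightarrow> ('i \<Rightarrow> int) \<Rightarrow> 'i \<Rightarrow> complex \<Rightarrow> 'i ymon" where
  "Aexp q C d i a =
     Yv i (a * inverse (q powi d i)) + Yv i (a * q powi d i)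
     - ((\<Sum>j\<in>{j. C j i = -1}. Yv j a)
        + (\<Sum>j\<in>{j. C j i = -2}. Yv j (a * inverse q) + Yv j (a * q))
        + (\<Sum>j\<in>{j. C j i = -3}. Yv j (a * inverse (q\<^sup>2)) + Yv j a + Yv j (a * q\<^sup>2)))"

definition Tmon :: "complex \<Rightarrow> ('i::finite \<Rightarrow> 'i \<Rightarrow> int) \<Rightarrow> ('i \<Rightarrow> int) \<Rightarrow> 'i \<Rightarrow> 'i ymon \<Rightarrow> 'i ymon" where
  "Tmon q C d i m = m -
     (\<Sum>k\<in>Poly_Mapping.keys m. if fst k = i then frag_cmul (Poly_Mapping.lookup m k) (Aexp q C d i (snd k * q powi d i)) else 0)"

definition Tchari :: "complex \<Rightarrow> ('i::finite \<Rightarrow> 'i \<Rightarrow> int) \<Rightarrow> ('i \<Rightarrow> int) \<Rightarrow> 'i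
    \<Rightarrow> ('i ymon \<Rightarrow>\<^sub>0 int) \<Rightarrow> ('i ymon \<Rightarrow>\<^sub>0 int)" where
  "Tchari q C d i f = (\<Sum>m\<in>Poly_Mapping.keys f. Poly_Mapping.single (Tmon q C d i m) (Poly_Mapping.lookup f m))"

text \<open>Y_{j,a} maps to [omega_j] Psi_{j,a q_j^-1} Psi_{j,a q_j}^-1; the monomial Y^m maps
  to the l-weight whose k-th component is
  q_k^{sum_a m(k,a)} prod_a ((1 - a q_k^-1 z)/(1 - a q_k z))^{m(k,a)}.\<close>
definition ywt :: "complex \<Rightarrow> ('i \<Rightarrow> int) \<Rightarrow> 'i ymon \<Rightarrow> 'i lweight" where
  "ywt q d m = (\<lambda>k.
     fps_const (q powi (d k * (\<Sum>p\<in>{p\<in>Poly_Mapping.keys m. fst p = k}. Poly_Mapping.lookup m p))) *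
     (\<Prod>p\<in>{p\<in>Poly_Mapping.keys m. fst p = k}.
        (lin (snd p * inverse (q powi d k)) * inverse (lin (snd p * q powi d k))) powi Poly_Mapping.lookup m p))"

definition iota :: "complex \<Rightarrow> ('i \<Rightarrow> int) \<Rightarrow> ('i ymon \<Rightarrow>\<^sub>0 int) \<Rightarrow> ('i lweight \<Rightarrow>\<^sub>0 int)" where
  "iota q d f = (\<Sum>m\<in>Poly_Mapping.keys f. Poly_Mapping.single (ywt q d m) (Poly_Mapping.lookup f m))"

end

theory Submission
  imports Defs "HOL-Library.Indicator_Function"
begin

text \<open>Write the group of invertible power series additively; it is a module over
  \<open>\<int>[t, t\<inverse>]\<close>, where \<open>t\<close> acts by \<open>z \<mapsto> q z\<close>. On l-weights \<open>T'\<^sub>i\<close> is then the transvection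
  \<open>x\<^sub>k \<mapsto> x\<^sub>k + p\<^sub>i\<^sub>k x\<^sub>i\<close> with Laurent polynomials satisfying \<open>p\<^sub>i\<^sub>k(1) = - C\<^sub>i\<^sub>k\<close>, so one formula accounts
  both for the generators \<open>\<Psi>\<^sub>j\<^sub>,\<^sub>a\<close> and for the Weyl group action on constants. With
  \<open>p\<^sub>i\<^sub>i = - 1 - a\<close> and \<open>p\<^sub>j\<^sub>j = - 1 - b\<close> the braid relation depends only on \<open>a\<close>, \<open>b\<close> and \<open>p\<^sub>i\<^sub>j p\<^sub>j\<^sub>i\<close>, which
  are \<open>a = b = p\<^sub>i\<^sub>j p\<^sub>j\<^sub>i\<close> for \<open>A\<^sub>2\<close>, \<open>b = a\<^sup>2\<close>, \<open>p\<^sub>i\<^sub>j p\<^sub>j\<^sub>i = a + a\<^sup>2\<close> for \<open>B\<^sub>2\<close>, and \<open>b = a\<^sup>3\<close>,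
  \<open>p\<^sub>i\<^sub>j p\<^sub>j\<^sub>i = a + a\<^sup>2 + a\<^sup>3\<close> for \<open>G\<^sub>2\<close>. This uses that \<open>d i = 1\<close> whenever \<open>C i j \<le> - 2\<close>, a consequence
  of positive definiteness. The images of the generators determine \<open>T'\<^sub>i\<close>, and the restriction to
  \<open>Y\<close> is compared on the variables \<open>Y\<^sub>j\<^sub>,\<^sub>a\<close>.\<close>

section \<open>Cartan matrices of finite type\<close>

definition sform :: "('i::finite \<Rightarrow> 'i \<Rightarrow> int) \<Rightarrow> ('i \<Rightarrow> int) \<Rightarrow> ('i \<Rightarrow> real) \<Rightarrow> ('i \<Rightarrow> real) \<Rightarrow> real" where
  "sform C d x y = (\<Sum>i\<in>UNIV. \<Sum>j\<in>UNIV. x i * of_int (d i * C i j) * y j)"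

lemma sform_add_left: "sform C d (\<lambda>i. x i + y i) z = sform C d x z + sform C d y z"
  by (simp add: sform_def algebra_simps sum.distrib)

lemma sform_add_right: "sform C d z (\<lambda>i. x i + y i) = sform C d z x + sform C d z y"
  by (simp add: sform_def algebra_simps sum.distrib)

definition pt :: "'i \<Rightarrow> real \<Rightarrow> 'i \<Rightarrow> real" where
  "pt m c = (\<lambda>i. if i = m then c else 0)"

lemma sform_pt_pt: "sform C d (pt l a) (pt m b) = a * of_int (d l * C l m) * b"
proof -
  have "sform C d (pt l a) (pt m b)
      = (\<Sum>i\<in>UNIV. \<Sum>j\<in>UNIV. if j = m then (if i = l then a * of_int (d i * C i j) * b else 0) else 0)"
    unfolding sform_def by (intro sum.cong) (auto simp: pt_def)
  then show ?thesis by (simp add: sum.delta)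
qed

lemma sform_indicator_pt:
  "sform C d (indicator K) (pt m b) = (\<Sum>l\<in>K. of_int (d l * C l m)) * b"
proof -
  have "sform C d (indicator K) (pt m b)
      = (\<Sum>i\<in>UNIV. \<Sum>j\<in>UNIV. if j = m then (if i \<in> K then of_int (d i * C i j) * b else 0) else 0)"
    unfolding sform_def by (intro sum.cong) (auto simp: pt_def indicator_def)
  also have "\<dots> = (\<Sum>i\<in>UNIV. if i \<in> K then of_int (d i * C i m) * b else 0)"
    by (simp add: sum.delta)
  also have "\<dots> = (\<Sum>l\<in>K. of_int (d l * C l m) * b)"
    by (simp add: sum.If_cases)
  finally show ?thesis by (simp add: sum_distrib_right)
qed

text \<open>The point is the vertex of the parabola \<open>2 * s * x + 2 * c * x\<^sup>2\<close>,
  whose minimum is \<open>- s\<^sup>2 / (2 * c)\<close>.\<close>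

lemma quadratic_at_vertex_le:
  fixes s c e :: real
  assumes "c > 0" "2 * e * c \<le> s\<^sup>2"
  shows "2 * s * (- s / (2 * c)) + 2 * c * (- s / (2 * c))\<^sup>2 \<le> - e"
proof -
  have "2 * s * (- s / (2 * c)) + 2 * c * (- s / (2 * c))\<^sup>2 = - (s\<^sup>2 / (2 * c))"
    using assms(1) by (simp add: field_simps power2_eq_square)
  moreover have "e \<le> s\<^sup>2 / (2 * c)" using assms by (simp add: field_simps)
  ultimately show ?thesis by simp
qed

context
  fixes C :: "'i::finite \<Rightarrow> 'i \<Rightarrow> int" and d :: "'i \<Rightarrow> int"
  assumes cartan: "cartan_simple C d"
begin

lemma cartan_diag: "C i i = 2"
  and cartan_nonpos: "i \<noteq> j \<Longrightarrow> C i j \<le> 0"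
  and cartan_zero_iff: "C i j = 0 \<longleftrightarrow> C j i = 0"
  and cartan_d_pos: "d i > 0"
  and cartan_sym: "d i * C i j = d j * C j i"
  and cartan_d_one: "\<exists>i. d i = 1"
  and cartan_pos_def: "x \<noteq> (\<lambda>_. 0) \<Longrightarrow> sform C d x x > 0"
  and cartan_connected: "S \<noteq> {} \<Longrightarrow> S \<noteq> UNIV \<Longrightarrow> \<exists>i\<in>S. \<exists>j. j \<notin> S \<and> C i j \<noteq> 0"
  using cartan unfolding cartan_simple_def sform_def by iprover+

lemma sform_sym: "sform C d x y = sform C d y x"
proof -
  have "sform C d x y = (\<Sum>j\<in>UNIV. \<Sum>i\<in>UNIV. x i * of_int (d i * C i j) * y j)"
    unfolding sform_def by (rule sum.swap)
  also have "\<dots> = sform C d y x"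
    unfolding sform_def
  proof (intro sum.cong refl)
    fix i j
    show "x i * of_int (d i * C i j) * y j = y j * of_int (d j * C j i) * x i"
      by (simp only: cartan_sym[of i j] ac_simps)
  qed
  finally show ?thesis .
qed

section \<open>Edges of the Dynkin diagram and the values of \<open>d\<close>\<close>

lemma cartan_prod_le_3:
  assumes "i \<noteq> j" shows "C i j * C j i \<le> 3"
proof -
  \<comment> \<open>Twice the part of the basis vector at \<open>j\<close> that is orthogonal to the
    one at \<open>i\<close>; the form then produces the factor
    \<open>4 - C i j * C j i\<close>.\<close>
  define x where "x = (\<lambda>l. pt i (- of_int (C i j)) l + pt j 2 l)"
  have "x j \<noteq> 0" using assms by (simp add: x_def pt_def)
  then have "0 < sform C d x x" by (intro cartan_pos_def) (auto simp: fun_eq_iff)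
  also have "sform C d x x = of_int (2 * (d j * (4 - C i j * C j i)))"
    by (simp add: x_def sform_add_left sform_add_right sform_pt_pt cartan_diag algebra_simps)
  finally have "0 < d j * (4 - C i j * C j i)" by (simp only: of_int_0_less_iff)
  then show ?thesis using cartan_d_pos[of j] by (simp add: zero_less_mult_iff)
qed

text \<open>Nonzero off-diagonal entries are at most -1, so the bound on their product leaves only
  these pairs; symmetry of \<open>d i * C i j\<close> gives the ratio of \<open>d i\<close> and
  \<open>d j\<close>.\<close>

lemma cartan_cases:
  assumes "i \<noteq> j"
  obtains "C i j = 0" "C j i = 0"
  | "C i j = -1" "C j i = -1" "d i = d j"
  | "C i j = -2" "C j i = -1" "d j = 2 * d i"
  | "C i j = -3" "C j i = -1" "d j = 3 * d i"
  | "C i j = -1" "C j i = -2" "d i = 2 * d j"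
  | "C i j = -1" "C j i = -3" "d i = 3 * d j"
proof -
  define a b where "a = - C i j" and "b = - C j i"
  have ab: "a \<ge> 0" "b \<ge> 0" "a * b \<le> 3" "a = 0 \<longleftrightarrow> b = 0" "d i * a = d j * b"
    using cartan_nonpos[OF assms] cartan_nonpos[OF assms[symmetric]] cartan_prod_le_3[OF assms]
      cartan_zero_iff[of i j] cartan_sym[of i j] by (auto simp: a_def b_def)
  have le: "a \<le> 3" if "b \<ge> 1"
    using mult_left_mono[OF that ab(1)] ab(3) by simp
  have le': "b \<le> 3" if "a \<ge> 1"
    using mult_right_mono[OF that ab(2)] ab(3) by simp
  have "(a = 0 \<and> b = 0) \<or> (a = 1 \<and> b = 1) \<or> (a = 2 \<and> b = 1) \<or> (a = 3 \<and> b = 1) \<or> (a = 1 \<and> b = 2) \<or> (a = 1 \<and> b = 3)"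
  proof (cases "a = 0")
    case False
    then have "a \<in> {1,2,3}" "b \<in> {1,2,3}" using ab le le' by auto
    then show ?thesis using ab by auto
  qed (use ab in auto)
  then show thesis
  proof (elim disjE conjE)
    assume "a = 0" "b = 0"
    then show thesis using that(1) ab(5) by (simp add: a_def b_def)
  next
    assume "a = 1" "b = 1"
    then show thesis using that(2) ab(5) by (simp add: a_def b_def)
  next
    assume "a = 2" "b = 1"
    then show thesis using that(3) ab(5) by (simp add: a_def b_def)
  next
    assume "a = 3" "b = 1"
    then show thesis using that(4) ab(5) by (simp add: a_def b_def)
  next
    assume "a = 1" "b = 2"
    then show thesis using that(5) ab(5) by (simp add: a_def b_def)
  next
    assume "a = 1" "b = 3"
    then show thesis using that(6) ab(5) by (simp add: a_def b_def)
  qed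
qed

text \<open>For a maximal set \<open>K\<close> the form on a combination of the indicator of \<open>K\<close> and two distinct
  outer neighbours would fail to be positive: the indicator contributes at most \<open>2 * d i\<close> and an
  optimally weighted neighbour at most \<open>- d i\<close>.\<close>
lemma equal_length_component:
  obtains K where "i \<in> K" "\<And>l. l \<in> K \<Longrightarrow> d l = d i"
    "\<And>l l' m m'. \<lbrakk>l \<in> K; l' \<in> K; m \<notin> K; m' \<notin> K; C l m \<noteq> 0; C l' m' \<noteq> 0\<rbrakk> \<Longrightarrow> m = m'"
proof -
  \<comment> \<open>The bound is the value of the form on \<open>{i}\<close>. It stands in for
    connectedness: a tree of single edges between vertices of this length attains it.\<close>
  define good where "good K \<longleftrightarrow> i \<in> K \<and> (\<forall>l\<in>K. d l = d i)
      \<and> sform C d (indicator K) (indicator K) \<le> 2 * of_int (d i)" for K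
  have ind1: "indicator {i} = pt i 1" by (auto simp: pt_def indicator_def fun_eq_iff)
  have "good {i}"
    by (simp add: good_def ind1 sform_pt_pt cartan_diag)
  then have "\<exists>K\<in>Collect good. {i} \<subseteq> K \<and> (\<forall>K'\<in>Collect good. K \<subseteq> K' \<longrightarrow> K = K')"
    by (intro finite_has_maximal2) simp_all
  then obtain K where K: "good K" and max: "\<And>K'. good K' \<Longrightarrow> K \<subseteq> K' \<Longrightarrow> K = K'"
    by blast
  have iK: "i \<in> K" and dK: "\<And>l. l \<in> K \<Longrightarrow> d l = d i"
    and QK: "sform C d (indicator K) (indicator K) \<le> 2 * of_int (d i)"
    using K unfolding good_def by blast+
  define s where "s m = (\<Sum>l\<in>K. of_int (d l * C l m) :: real)" for m
  have s_le: "s m \<le> of_int (d l * C l m)" if "l \<in> K" "m \<notin> K" for l m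
  proof -
    have "s m = of_int (d l * C l m) + (\<Sum>l\<in>K - {l}. of_int (d l * C l m))"
      unfolding s_def by (rule sum.remove) (use that in auto)
    moreover have "(\<Sum>l\<in>K - {l}. of_int (d l * C l m) :: real) \<le> 0"
    proof (rule sum_nonpos)
      fix k assume k: "k \<in> K - {l}"
      then have "k \<noteq> m" using that by auto
      then have "d k * C k m \<le> 0"
        using cartan_nonpos[of k m] cartan_d_pos[of k] by (simp add: mult_le_0_iff)
      then show "of_int (d k * C k m) \<le> (0::real)" by (simp only: of_int_le_0_iff)
    qed
    ultimately show ?thesis by simp
  qed
  \<comment> \<open>Otherwise \<open>insert m K\<close> would again be good, since it changes the
    form by \<open>2 * s m + 2 * d m \<le> 0\<close>, against maximality of
    \<open>K\<close>.\<close>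
  have d_ne: "d m \<noteq> d i" if "l \<in> K" "m \<notin> K" "C l m \<noteq> 0" for l m
  proof
    assume dm: "d m = d i"
    have "C l m \<le> -1" using cartan_nonpos[of l m] that by (cases "l = m") auto
    then have "d l * C l m \<le> d l * (-1)"
      by (intro mult_left_mono) (auto intro: less_imp_le cartan_d_pos)
    then have "of_int (d l * C l m) \<le> (of_int (- d i) :: real)"
      using dK[OF that(1)] by (simp only: of_int_le_iff)
    then have sm: "s m \<le> - of_int (d i)" using s_le[OF that(1,2)] by simp
    have ind: "indicator (insert m K) = (\<lambda>k. indicator K k + pt m 1 k :: real)"
      using that by (auto simp: pt_def indicator_def fun_eq_iff)
    have "sform C d (indicator (insert m K)) (indicator (insert m K))
        = sform C d (indicator K) (indicator K) + 2 * s m + 2 * of_int (d m)"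
      using sform_sym[of "pt m 1" "indicator K"]
      by (simp add: ind sform_add_left sform_add_right sform_indicator_pt sform_pt_pt cartan_diag
          s_def)
    also have "\<dots> \<le> 2 * of_int (d i)" using QK sm dm by simp
    finally have "good (insert m K)" using iK dK dm unfolding good_def by blast
    then show False using max that by blast
  qed
  \<comment> \<open>Different lengths exclude a single edge, so \<open>C l m * C m l\<close> is at
    least 2; by symmetry \<open>(d l * C l m)\<^sup>2\<close> is this product times
    \<open>d l * d m\<close>.\<close>
  have s_sq: "s m < 0 \<and> 2 * of_int (d i) * of_int (d m) \<le> (s m)\<^sup>2"
    if "l \<in> K" "m \<notin> K" "C l m \<noteq> 0" for l m
  proof -
    have ne: "l \<noteq> m" using that by auto
    have neg: "C l m < 0" using cartan_nonpos[OF ne] that by simp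
    have "C l m * C m l \<ge> 2"
      using ne by (rule cartan_cases) (use that d_ne[OF that] dK[OF that(1)] in auto)
    then have "2 * (d l * d m) \<le> (C l m * C m l) * (d l * d m)"
      by (intro mult_right_mono) (simp_all add: cartan_d_pos less_imp_le)
    also have "\<dots> = (d l * C l m) * (d m * C m l)" by simp
    also have "\<dots> = (d l * C l m)\<^sup>2" by (simp only: cartan_sym[of m l] power2_eq_square)
    finally have 1: "2 * (d i * d m) \<le> (d l * C l m)\<^sup>2" using dK[OF that(1)] by simp
    have neg': "d l * C l m < 0" using neg cartan_d_pos[of l] by (simp add: mult_pos_neg)
    have "of_int (2 * (d i * d m)) \<le> (of_int ((d l * C l m)\<^sup>2) :: real)"
      using 1 by (simp only: of_int_le_iff)
    also have "\<dots> = (- of_int (d l * C l m))\<^sup>2" by simp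
    also have "\<dots> \<le> (- s m)\<^sup>2"
      by (rule power_mono) (use s_le[OF that(1,2)] neg' in \<open>simp_all only: neg_le_iff_le neg_0_le_iff_le of_int_le_0_iff less_imp_le\<close>)
    finally have 2: "2 * of_int (d i) * of_int (d m) \<le> (s m)\<^sup>2" by simp
    have "of_int (d l * C l m) < (0::real)" using neg' by (simp only: of_int_less_0_iff)
    with s_le[OF that(1,2)] 2 show ?thesis by simp
  qed
  have uniq: "m = m'" if "l \<in> K" "l' \<in> K" "m \<notin> K" "m' \<notin> K" "C l m \<noteq> 0" "C l' m' \<noteq> 0" for l l' m m'
  proof (rule ccontr)
    assume ne: "m \<noteq> m'"
    \<comment> \<open>The weights minimise the contributions of the two neighbours. Both are
      positive, so the mixed term has the sign of \<open>C m m'\<close> and is not positive.\<close>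
    define x where "x = - s m / (2 * of_int (d m))"
    define x' where "x' = - s m' / (2 * of_int (d m'))"
    note s1 = s_sq[OF that(1,3,5)] and s2 = s_sq[OF that(2,4,6)]
    have dp: "(of_int (d m) :: real) > 0" "(of_int (d m') :: real) > 0" using cartan_d_pos by auto
    have x0: "x > 0" "x' > 0" using s1 s2 dp by (auto simp: x_def x'_def intro!: divide_neg_pos)
    define v where "v = (\<lambda>k. indicator K k + (pt m x k + pt m' x' k) :: real)"
    have "v i \<noteq> 0" using iK that by (auto simp: v_def pt_def)
    then have "0 < sform C d v v" by (intro cartan_pos_def) (auto simp: fun_eq_iff)
    also have "sform C d v v = sform C d (indicator K) (indicator K)
        + (2 * s m * x + 2 * of_int (d m) * x\<^sup>2) + (2 * s m' * x' + 2 * of_int (d m') * x'\<^sup>2)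
        + 2 * (x * of_int (d m * C m m') * x')"
      using sform_sym[of "pt m x" "indicator K"] sform_sym[of "pt m' x'" "indicator K"]
        sform_sym[of "pt m' x'" "pt m x"]
      by (simp add: v_def sform_add_left sform_add_right sform_indicator_pt sform_pt_pt cartan_diag
          power2_eq_square s_def)
    also have "\<dots> \<le> 2 * of_int (d i) + (- of_int (d i)) + (- of_int (d i)) + 0"
    proof (intro add_mono QK)
      show "2 * s m * x + 2 * of_int (d m) * x\<^sup>2 \<le> - of_int (d i)"
        unfolding x_def using s1 dp by (intro quadratic_at_vertex_le) auto
      show "2 * s m' * x' + 2 * of_int (d m') * x'\<^sup>2 \<le> - of_int (d i)"
        unfolding x'_def using s2 dp by (intro quadratic_at_vertex_le) auto
      have "d m * C m m' \<le> 0"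
        using cartan_nonpos[OF ne] cartan_d_pos[of m] by (simp add: mult_le_0_iff)
      then have "of_int (d m * C m m') \<le> (0::real)" by (simp only: of_int_le_0_iff)
      then show "2 * (x * of_int (d m * C m m') * x') \<le> 0"
        using x0 by (auto simp: mult_le_0_iff zero_le_mult_iff simp del: of_int_mult)
    qed
    finally show False by simp
  qed
  show thesis
    by (rule that[of K]) (fact iK, erule dK, rule uniq)
qed

text \<open>The set \<open>K\<close> around \<open>i\<close> has \<open>j\<close> as its only outer
  neighbour, and the set \<open>L\<close> around \<open>j\<close> has only \<open>i\<close>. By
  connectedness they exhaust the diagram, so \<open>d\<close> takes just the values
  \<open>d i\<close> and \<open>d j\<close>; as \<open>d j \<ge> 2 * d i\<close>, the value 1 must
  be \<open>d i\<close>.\<close>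

lemma cartan_multiple_edge_d:
  assumes "C i j \<le> -2" shows "d i = 1"
proof -
  have ne: "i \<noteq> j" using assms cartan_diag[of i] by auto
  have dij: "C i j \<noteq> 0 \<and> C j i \<noteq> 0 \<and> 2 * d i \<le> d j"
    using ne by (rule cartan_cases) (use assms cartan_d_pos[of i] in auto)
  have dne: "d i \<noteq> d j" "d j \<noteq> 1" using dij cartan_d_pos[of i] by auto
  obtain K where K: "i \<in> K" "\<And>l. l \<in> K \<Longrightarrow> d l = d i"
    "\<And>l l' m m'. \<lbrakk>l \<in> K; l' \<in> K; m \<notin> K; m' \<notin> K; C l m \<noteq> 0; C l' m' \<noteq> 0\<rbrakk> \<Longrightarrow> m = m'"
    by (rule equal_length_component[of i]) (rule that)
  obtain L where L: "j \<in> L" "\<And>l. l \<in> L \<Longrightarrow> d l = d j"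
    "\<And>l l' m m'. \<lbrakk>l \<in> L; l' \<in> L; m \<notin> L; m' \<notin> L; C l m \<noteq> 0; C l' m' \<noteq> 0\<rbrakk> \<Longrightarrow> m = m'"
    by (rule equal_length_component[of j]) (rule that)
  have "j \<notin> K" "i \<notin> L" using K(2)[of j] L(2)[of i] dne by auto
  have "K \<union> L = UNIV"
  proof (rule ccontr)
    assume "K \<union> L \<noteq> UNIV"
    then obtain l m where lm: "l \<in> K \<union> L" "m \<notin> K \<union> L" "C l m \<noteq> 0"
      using cartan_connected[of "K \<union> L"] K(1) by blast
    have "l \<in> K \<Longrightarrow> m = j"
      using K(3)[of l i m j] lm dij K(1) \<open>j \<notin> K\<close> by simp
    moreover have "l \<in> L \<Longrightarrow> m = i"
      using L(3)[of l j m i] lm dij L(1) \<open>i \<notin> L\<close> by simp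
    ultimately show False using lm K(1) L(1) by auto
  qed
  moreover obtain k where "d k = 1" using cartan_d_one by blast
  ultimately have "k \<in> K \<or> k \<in> L" "d k = 1" by blast+
  then show ?thesis using K(2)[of k] L(2)[of k] dne by auto
qed

end


section \<open>Braid relations for transvections\<close>

definition transvect :: "('r \<Rightarrow> 'm \<Rightarrow> 'm) \<Rightarrow> ('i \<Rightarrow> 'i \<Rightarrow> 'r) \<Rightarrow> 'i \<Rightarrow> ('i \<Rightarrow> 'm::ab_group_add) \<Rightarrow> 'i \<Rightarrow> 'm" where
  "transvect sc P i x = (\<lambda>k. x k + sc (P i k) (x i))"

text \<open>Every word in the transvections at \<open>i\<close> and \<open>j\<close> has this form, which reduces a braid relation to
  four identities in the ring.\<close>
definition rank2 :: "('r::comm_ring_1 \<Rightarrow> 'm \<Rightarrow> 'm) \<Rightarrow> ('i \<Rightarrow> 'i \<Rightarrow> 'r) \<Rightarrow> 'i \<Rightarrow> 'i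
    \<Rightarrow> 'r \<Rightarrow> 'r \<Rightarrow> 'r \<Rightarrow> 'r \<Rightarrow> ('i \<Rightarrow> 'm::ab_group_add) \<Rightarrow> 'i \<Rightarrow> 'm" where
  "rank2 sc P i j A B C E x = (\<lambda>k. x k + sc (A * P i k + B * P i j * P j k) (x i)
     + sc (C * P j i * P i k + E * P j k) (x j))"

context module
begin

text \<open>The transvection at \<open>i\<close> alters only \<open>A\<close> and \<open>C\<close>,
  the one at \<open>j\<close> only \<open>B\<close> and \<open>E\<close>. Every product
  \<open>P i j * P j i\<close> that arises is replaced by \<open>p\<close>, so words obey a
  recursion in \<open>a\<close>, \<open>b\<close> and \<open>p\<close> alone.\<close>

lemma transvect_rank2:
  assumes "P i i = -1 - a" "P j j = -1 - b" "P i j * P j i = p"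
  shows "transvect (*s) P i (rank2 (*s) P i j A B C E x) = rank2 (*s) P i j (1 - a * A + p * B) B (E - a * C) E x"
    and "transvect (*s) P j (rank2 (*s) P i j A B C E x) = rank2 (*s) P i j A (A - b * B) C (1 - b * E + p * C) x"
proof -
  have coeffs:
    "P i k * (1 + A * P i i + B * P i j * P j i) + (A * P i k + B * P i j * P j k)
      = (1 - a * A + p * B) * P i k + B * P i j * P j k"
    "P i k * (C * P j i * P i i + E * P j i) + (C * P j i * P i k + E * P j k)
      = (E - a * C) * P j i * P i k + E * P j k"
    "P j k * (A * P i j + B * P i j * P j j) + (A * P i k + B * P i j * P j k)
      = A * P i k + (A - b * B) * P i j * P j k"
    "P j k * (1 + C * P j i * P i j + E * P j j) + (C * P j i * P i k + E * P j k)
      = C * P j i * P i k + (1 - b * E + p * C) * P j k" for k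
    unfolding assms(1,2) assms(3)[symmetric] by (simp_all add: algebra_simps)
  show "transvect (*s) P i (rank2 (*s) P i j A B C E x) = rank2 (*s) P i j (1 - a * A + p * B) B (E - a * C) E x"
    unfolding rank2_def transvect_def coeffs(1,2)[symmetric] by (simp add: algebra_simps)
  show "transvect (*s) P j (rank2 (*s) P i j A B C E x) = rank2 (*s) P i j A (A - b * B) C (1 - b * E + p * C) x"
    unfolding rank2_def transvect_def coeffs(3,4)[symmetric] by (simp add: algebra_simps)
qed

text \<open>The empty word, from which the recursion starts in each braid relation.\<close>

lemma rank2_zero: "rank2 (*s) P i j 0 0 0 0 x = x"
  by (simp add: rank2_def)

lemma rank2_cong: "\<lbrakk>A = A'; B = B'; C = C'; E = E'\<rbrakk> \<Longrightarrow> rank2 (*s) P i j A B C E x = rank2 (*s) P i j A' B' C' E' x"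
  by simp

lemma transvect_braid_A1A1:
  assumes "P i i = -1 - a" "P j j = -1 - b" "P i j = 0" "P j i = 0"
  shows "alt (transvect (*s) P i) (transvect (*s) P j) 2 x = alt (transvect (*s) P j) (transvect (*s) P i) 2 x"
proof -
  have "P i j * P j i = 0" using assms by simp
  note step = transvect_rank2[OF assms(1,2) this]
  have "alt (transvect (*s) P i) (transvect (*s) P j) 2 (rank2 (*s) P i j 0 0 0 0 x)
      = alt (transvect (*s) P j) (transvect (*s) P i) 2 (rank2 (*s) P i j 0 0 0 0 x)"
    \<comment> \<open>The two words end with different \<open>B\<close> and \<open>C\<close>, but
      these are multiplied by \<open>P i j\<close> and \<open>P j i\<close>, which vanish.\<close>
    by (simp add: numeral_eq_Suc step) (simp add: rank2_def assms)
  then show ?thesis by (simp add: rank2_zero)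
qed

text \<open>Both words end with all four coefficients equal to 1.\<close>

lemma transvect_braid_A2:
  assumes "P i i = -1 - a" "P j j = -1 - a" "P i j * P j i = a"
  shows "alt (transvect (*s) P i) (transvect (*s) P j) 3 x = alt (transvect (*s) P j) (transvect (*s) P i) 3 x"
proof -
  note step = transvect_rank2[OF assms]
  have "alt (transvect (*s) P i) (transvect (*s) P j) 3 (rank2 (*s) P i j 0 0 0 0 x)
      = alt (transvect (*s) P j) (transvect (*s) P i) 3 (rank2 (*s) P i j 0 0 0 0 x)"
    by (simp add: numeral_eq_Suc step)
  then show ?thesis by (simp add: rank2_zero)
qed

text \<open>Both words end with \<open>A = 1 + a * a\<close>, \<open>B = C = 1\<close> and
  \<open>E = 1 + a\<close>.\<close>

lemma transvect_braid_B2: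
  assumes "P i i = -1 - a" "P j j = -1 - a * a" "P i j * P j i = a + a * a"
  shows "alt (transvect (*s) P i) (transvect (*s) P j) 4 x = alt (transvect (*s) P j) (transvect (*s) P i) 4 x"
proof -
  note step = transvect_rank2[OF assms]
  have "alt (transvect (*s) P i) (transvect (*s) P j) 4 (rank2 (*s) P i j 0 0 0 0 x)
      = alt (transvect (*s) P j) (transvect (*s) P i) 4 (rank2 (*s) P i j 0 0 0 0 x)"
    by (simp add: numeral_eq_Suc step algebra_simps)
  then show ?thesis by (simp add: rank2_zero)
qed

text \<open>Both words end with \<open>A = 1 + a^2 + a^3 + a^5\<close>,
  \<open>B = C = 1 + a^2\<close> and \<open>E = 1 + a + a^2 + a^3\<close>.\<close>

lemma transvect_braid_G2:
  assumes "P i i = -1 - a" "P j j = -1 - a * a * a" "P i j * P j i = a + a * a + a * a * a"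
  shows "alt (transvect (*s) P i) (transvect (*s) P j) 6 x = alt (transvect (*s) P j) (transvect (*s) P i) 6 x"
proof -
  note step = transvect_rank2[OF assms]
  have "alt (transvect (*s) P i) (transvect (*s) P j) 6 (rank2 (*s) P i j 0 0 0 0 x)
      = alt (transvect (*s) P j) (transvect (*s) P i) 6 (rank2 (*s) P i j 0 0 0 0 x)"
    by (simp add: numeral_eq_Suc step) (rule rank2_cong; simp add: algebra_simps)
  then show ?thesis by (simp add: rank2_zero)
qed

text \<open>Since \<open>1 + P i i = - a\<close>, the transvection multiplies coordinate
  \<open>i\<close> by \<open>- a\<close>; adding \<open>b * P i k\<close> times the new coordinate
  therefore removes the \<open>P i k *s x i\<close> added before.\<close>

lemma transvect_inverse:
  assumes "P i i = -1 - a" "a * b = 1"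
  shows "transvect (*s) (\<lambda>i k. b * P i k) i (transvect (*s) P i x) = x"
    and "transvect (*s) P i (transvect (*s) (\<lambda>i k. b * P i k) i x) = x"
proof -
  have 1: "P i k + b * P i k + b * P i k * P i i = 0" for k
    using arg_cong[OF assms(2), of "\<lambda>c. c * P i k"] unfolding assms(1) by (simp add: algebra_simps)
  have 2: "b * P i k + (P i k + P i k * (b * P i i)) = 0" for k
    using 1[of k] by (simp add: algebra_simps)
  show "transvect (*s) (\<lambda>i k. b * P i k) i (transvect (*s) P i x) = x"
  proof
    fix k
    have "transvect (*s) (\<lambda>i k. b * P i k) i (transvect (*s) P i x) k
      = x k + (P i k + b * P i k + b * P i k * P i i) *s x i"
      by (simp add: transvect_def algebra_simps)
    then show "transvect (*s) (\<lambda>i k. b * P i k) i (transvect (*s) P i x) k = x k"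
      by (simp only: 1) simp
  qed
  show "transvect (*s) P i (transvect (*s) (\<lambda>i k. b * P i k) i x) = x"
  proof
    fix k
    have "transvect (*s) P i (transvect (*s) (\<lambda>i k. b * P i k) i x) k
      = x k + (b * P i k + (P i k + P i k * (b * P i i))) *s x i"
      by (simp add: transvect_def algebra_simps)
    then show "transvect (*s) P i (transvect (*s) (\<lambda>i k. b * P i k) i x) k = x k"
      by (simp only: 2) simp
  qed
qed

end


section \<open>Invertible power series as a module over Laurent polynomials\<close>

unbundle fps_syntax

typedef unit_fps = "{f :: complex fps. f $ 0 \<noteq> 0}"
  by (rule exI[of _ 1]) simp

setup_lifting type_definition_unit_fps

instantiation unit_fps :: ab_group_add
begin

lift_definition zero_unit_fps :: unit_fps is 1 by simp
lift_definition plus_unit_fps :: "unit_fps \<Rightarrow> unit_fps \<Rightarrow> unit_fps" is "(*)" by simp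
lift_definition uminus_unit_fps :: "unit_fps \<Rightarrow> unit_fps" is inverse by simp
definition minus_unit_fps :: "unit_fps \<Rightarrow> unit_fps \<Rightarrow> unit_fps" where "minus_unit_fps x y = x + - y"

instance
proof
  fix a b c :: unit_fps
  show "a + b + c = a + (b + c)" by transfer (simp add: ac_simps)
  show "a + b = b + a" by transfer (simp add: ac_simps)
  show "0 + a = a" by transfer simp
  show "- a + a = 0" by transfer (simp add: inverse_mult_eq_1)
  show "a - b = a + - b" by (rule minus_unit_fps_def)
qed

end

section \<open>Integer powers as integer multiples in additive notation\<close>

lift_definition ipow :: "int \<Rightarrow> unit_fps \<Rightarrow> unit_fps" is "\<lambda>n f. f powi n"
  by (auto simp: power_int_def fps_power_zeroth)

lemma ipow_0 [simp]: "ipow 0 u = 0" and ipow_1 [simp]: "ipow 1 u = u"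
  by (transfer; simp)+

lemma ipow_succ: "ipow (n + 1) u = ipow n u + u"
proof transfer
  fix n :: int and f :: "complex fps"
  assume f: "f $ 0 \<noteq> 0"
  show "f powi (n + 1) = f powi n * f"
  proof (cases "n \<ge> 0")
    case True
    then show ?thesis by (simp add: power_int_def nat_add_distrib)
  next
    case False
    then obtain m where "n = - int (Suc m)"
      by (metis add.commute int_cases not_le of_nat_0_le_iff)
    then show ?thesis
      using f inverse_mult_eq_1[of f] by (auto simp: power_int_def nat_add_distrib ac_simps)
  qed
qed

lemma ipow_add: "ipow (m + n) u = ipow m u + ipow n u"
proof (induction n rule: int_induct[of _ 0])
  case (step1 n)
  then show ?case using ipow_succ[of "m + n" u] ipow_succ[of n u] by (simp add: algebra_simps)
next
  case (step2 n)
  then show ?case using ipow_succ[of "m + (n - 1)" u] ipow_succ[of "n - 1" u] by (simp add: algebra_simps)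
qed simp

lemma ipow_diff: "ipow (m - n) u = ipow m u - ipow n u"
  using ipow_add[of "m - n" n u] by simp

lemma ipow_plus: "ipow n (u + v) = ipow n u + ipow n v"
proof (induction n rule: int_induct[of _ 0])
  case (step1 n)
  then show ?case by (simp add: ipow_succ)
next
  case (step2 n)
  then show ?case by (simp add: ipow_diff)
qed simp

lemma ipow_sum: "ipow (sum f S) u = (\<Sum>s\<in>S. ipow (f s) u)"
  by (induction S rule: infinite_finite_induct) (simp_all add: ipow_add)

lemma ipow_0_right [simp]: "ipow n 0 = 0"
  using ipow_plus[of n 0 0] by simp

lemma Rep_unit_fps_diff: "Rep_unit_fps (u - v) = Rep_unit_fps u * inverse (Rep_unit_fps v)"
  by (simp only: minus_unit_fps_def plus_unit_fps.rep_eq uminus_unit_fps.rep_eq)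

lemma Rep_unit_fps_sum: "Rep_unit_fps (sum f S) = (\<Prod>s\<in>S. Rep_unit_fps (f s))"
  by (induction S rule: infinite_finite_induct)
    (simp_all add: zero_unit_fps.rep_eq plus_unit_fps.rep_eq)

section \<open>Substitutions in the variable and the action of Laurent polynomials\<close>

lift_definition rescale :: "complex \<Rightarrow> unit_fps \<Rightarrow> unit_fps" is
  "\<lambda>c f. f oo (fps_const c * fps_X)" by simp

lemma rescale_add: "rescale c (u + v) = rescale c u + rescale c v"
  by transfer (simp add: fps_compose_mult_distrib)

lemma rescale_0 [simp]: "rescale c 0 = 0"
  by transfer simp

lemma rescale_diff: "rescale c (u - v) = rescale c u - rescale c v"
  using rescale_add[of c "u - v" v] by simp

lemma rescale_1 [simp]: "rescale 1 u = u"
  by transfer simp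

lemma rescale_rescale: "rescale a (rescale b u) = rescale (a * b) u"
  by transfer (simp add: fps_compose_linear power_mult_distrib fps_eq_iff)

text \<open>The homomorphism from the free abelian group that extends \<open>y\<close>. It serves
  both for Laurent polynomials acting on series and for exponent vectors of monomials in the
  \<open>Y\<close> variables.\<close>

definition lincomb :: "('a \<Rightarrow> unit_fps) \<Rightarrow> ('a \<Rightarrow>\<^sub>0 int) \<Rightarrow> unit_fps" where
  "lincomb y m = (\<Sum>p\<in>Poly_Mapping.keys m. ipow (Poly_Mapping.lookup m p) (y p))"

lemma lincomb_0 [simp]: "lincomb y 0 = 0"
  by (simp add: lincomb_def)

lemma lincomb_of [simp]: "lincomb y (frag_of p) = y p"
  by (simp add: lincomb_def)

lemma lincomb_diff: "lincomb y (m - m') = lincomb y m - lincomb y m'"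
proof -
  let ?S = "Poly_Mapping.keys m \<union> Poly_Mapping.keys m'"
  have superset: "lincomb y F = (\<Sum>p\<in>?S. ipow (Poly_Mapping.lookup F p) (y p))"
    if "Poly_Mapping.keys F \<subseteq> ?S" for F
    unfolding lincomb_def using that by (intro sum.mono_neutral_left) (auto simp: in_keys_iff)
  show ?thesis
    using keys_diff[of m m'] by (simp add: superset lookup_minus ipow_diff sum_subtractf)
qed

lemma lincomb_add: "lincomb y (m + m') = lincomb y m + lincomb y m'"
  using lincomb_diff[of y "m + m'" m'] by simp

lemma lincomb_sum: "lincomb y (sum f S) = (\<Sum>s\<in>S. lincomb y (f s))"
  by (induction S rule: infinite_finite_induct) (simp_all add: lincomb_add)

text \<open>Under convolution \<open>int \<Rightarrow>\<^sub>0 int\<close> is the ring of Laurent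
  polynomials.\<close>

definition act :: "complex \<Rightarrow> (int \<Rightarrow>\<^sub>0 int) \<Rightarrow> unit_fps \<Rightarrow> unit_fps" where
  "act q F u = lincomb (\<lambda>n. rescale (q powi n) u) F"

lemma act_0_left [simp]: "act q 0 u = 0"
  by (simp add: act_def)

lemma act_of [simp]: "act q (frag_of n) u = rescale (q powi n) u"
  by (simp add: act_def)

lemma act_diff_left: "act q (F - G) u = act q F u - act q G u"
  by (simp add: act_def lincomb_diff)

lemma act_minus_left: "act q (- F) u = - act q F u"
  using act_diff_left[of q 0 F u] by simp

lemma act_add_left: "act q (F + G) u = act q F u + act q G u"
  using act_diff_left[of q F "- G" u] by (simp add: act_minus_left)

lemma act_add_right: "act q F (u + v) = act q F u + act q F v"
  by (simp add: act_def lincomb_def rescale_add ipow_plus sum.distrib)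

lemma act_0_right [simp]: "act q F 0 = 0"
  using act_add_right[of q F 0 0] by simp

lemma act_diff_right: "act q F (u - v) = act q F u - act q F v"
  using act_add_right[of q F "u - v" v] by simp

lemma act_mult:
  assumes "q \<noteq> 0"
  shows "act q (F * G) u = act q F (act q G u)"
proof (induction F rule: frag_induction[OF subset_UNIV])
  case (2 m)
  show ?case
  proof (induction G rule: frag_induction[OF subset_UNIV])
    case (2 n)
    then show ?case
      using assms by (simp add: mult_single rescale_rescale power_int_add)
  next
    case (3 F G)
    then show ?case by (simp add: right_diff_distrib act_diff_left rescale_diff)
  qed simp
next
  case (3 F G)
  then show ?case by (simp add: left_diff_distrib act_diff_left)
qed simp

lemma module_act:
  assumes "q \<noteq> 0"
  shows "module (act q)"
proof
  show "act q 1 u = u" for u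
    using act_of[of q 0 u] by (simp del: act_of)
qed (simp_all add: act_add_left act_add_right act_mult[OF assms])


section \<open>The group ring of l-weights\<close>

lemma lwmul_assoc: "lwmul (lwmul x y) z = lwmul x (lwmul y z)"
  by (simp add: lwmul_def ac_simps)

lemma lwmul_lw1 [simp]: "lwmul lw1 x = x" "lwmul x lw1 = x"
  by (simp_all add: lwmul_def lw1_def)

lemma frag_cmul_single: "frag_cmul c (Poly_Mapping.single x n) = Poly_Mapping.single x (c * n)"
  by (rule poly_mapping_eqI) (simp add: lookup_single when_def)

text \<open>This form makes the product visibly biadditive, so that identities reduce to group
  elements by \<open>frag_induction\<close>.\<close>

lemma conv_eq: "conv f g = frag_extend (\<lambda>x. frag_extend (\<lambda>y. gel (lwmul x y)) g) f"
  by (simp add: conv_def frag_extend_def frag_cmul_sum gel_def frag_cmul_single)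

lemma conv_diff_left: "conv (f - g) h = conv f h - conv g h"
  by (simp add: conv_eq frag_extend_diff)

lemma conv_diff_right: "conv f (g - h) = conv f g - conv f h"
proof (induction f rule: frag_induction[OF subset_UNIV])
  case (3 a b)
  then show ?case by (simp add: conv_diff_left)
qed (simp_all add: conv_eq frag_extend_diff)

lemma conv_zero [simp]: "conv 0 g = 0" "conv f 0 = 0"
  using conv_diff_left[of 0 0 g] conv_diff_right[of f 0 0] by simp_all

lemma conv_gel_gel [simp]: "conv (gel x) (gel y) = gel (lwmul x y)"
  by (simp add: conv_eq) (simp add: gel_def)

lemma conv_gel_lw1 [simp]: "conv (gel lw1) g = g"
proof (induction g rule: frag_induction[OF subset_UNIV])
  case (2 x)
  then show ?case using conv_gel_gel[of lw1 x] by (simp add: gel_def)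
next
  case (3 a b)
  then show ?case by (simp add: conv_diff_right)
qed simp

text \<open>The instance of associativity that permits cancelling a group element.\<close>

lemma conv_gel_conv_gel: "conv (gel x) (conv (gel y) g) = conv (gel (lwmul x y)) g"
proof (induction g rule: frag_induction[OF subset_UNIV])
  case (2 z)
  have "conv (gel x) (conv (gel y) (gel z)) = conv (gel (lwmul x y)) (gel z)"
    by (simp add: lwmul_assoc)
  then show ?case by (simp only: gel_def)
next
  case (3 a b)
  then show ?case by (simp add: conv_diff_right)
qed simp

section \<open>The subring \<open>Yp\<close> and additive maps on it\<close>

lemma Yp_0 [simp]: "0 \<in> Yp q d"
  by (simp add: Yp_def)

lemma Yp_gel [simp]: "gel x \<in> Yp q d \<longleftrightarrow> x \<in> lwgroup q d"
  by (simp add: Yp_def gel_def)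

lemma Yp_diff: "f \<in> Yp q d \<Longrightarrow> g \<in> Yp q d \<Longrightarrow> f - g \<in> Yp q d"
  using keys_diff[of f g] by (auto simp: Yp_def)

lemma Yp_induct [consumes 1, case_names zero gel diff]:
  assumes "f \<in> Yp q d" "P 0" "\<And>x. x \<in> lwgroup q d \<Longrightarrow> P (gel x)"
    "\<And>f g. \<lbrakk>f \<in> Yp q d; g \<in> Yp q d; P f; P g\<rbrakk> \<Longrightarrow> P (f - g)"
  shows "P f"
proof -
  have "Poly_Mapping.keys f \<subseteq> lwgroup q d" using assms(1) by (simp add: Yp_def)
  then have "f \<in> Yp q d \<and> P f"
    by (induction f rule: frag_induction)
      (use assms(2-4) in \<open>auto simp: Yp_diff simp flip: gel_def\<close>)
  then show ?thesis ..
qed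

text \<open>Differences match the closure step of \<open>Yp_induct\<close>; the first conjunct makes
  the property pass to compositions.\<close>

definition additive_on_Yp :: "complex \<Rightarrow> ('i \<Rightarrow> int) \<Rightarrow> (('i lweight \<Rightarrow>\<^sub>0 int) \<Rightarrow> ('i lweight \<Rightarrow>\<^sub>0 int)) \<Rightarrow> bool" where
  "additive_on_Yp q d h \<longleftrightarrow> (\<forall>f\<in>Yp q d. h f \<in> Yp q d) \<and>
     (\<forall>f\<in>Yp q d. \<forall>g\<in>Yp q d. h (f - g) = h f - h g)"

lemma additive_on_Yp_alt:
  assumes "additive_on_Yp q d s" "additive_on_Yp q d t"
  shows "additive_on_Yp q d (alt s t n)"
  using assms
  by (induction s t n rule: alt.induct) (simp_all add: additive_on_Yp_def)

lemma additive_on_Yp_eqI: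
  assumes "additive_on_Yp q d s" "additive_on_Yp q d t"
    and "\<And>x. x \<in> lwgroup q d \<Longrightarrow> s (gel x) = t (gel x)" and "f \<in> Yp q d"
  shows "s f = t f"
  using assms(4)
proof (induction f rule: Yp_induct)
  case zero
  have "h 0 = 0" if "additive_on_Yp q d h" for h
    using that unfolding additive_on_Yp_def by (metis Yp_0 diff_self)
  from this[OF assms(1)] this[OF assms(2)] show ?case by simp
qed (use assms in \<open>auto simp: additive_on_Yp_def\<close>)

lemma ring_aut_Yp_additive:
  assumes "ring_aut_Yp q d t"
  shows "additive_on_Yp q d t"
  unfolding additive_on_Yp_def
proof (intro conjI ballI)
  show "t f \<in> Yp q d" if "f \<in> Yp q d" for f
    using assms that unfolding ring_aut_Yp_def bij_betw_def by blast
  show "t (f - g) = t f - t g" if "f \<in> Yp q d" "g \<in> Yp q d" for f g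
  proof -
    have "t ((f - g) + g) = t (f - g) + t g"
      using assms that Yp_diff[OF that] unfolding ring_aut_Yp_def by blast
    then show ?thesis by simp
  qed
qed

section \<open>Ring maps induced by maps of l-weights\<close>

definition gr_map :: "('i lweight \<Rightarrow> 'i lweight) \<Rightarrow> ('i lweight \<Rightarrow>\<^sub>0 int) \<Rightarrow> ('i lweight \<Rightarrow>\<^sub>0 int)" where
  "gr_map \<phi> = frag_extend (\<lambda>x. gel (\<phi> x))"

lemma gr_map_gel [simp]: "gr_map \<phi> (gel x) = gel (\<phi> x)"
  by (simp add: gr_map_def gel_def)

lemma gr_map_diff: "gr_map \<phi> (f - g) = gr_map \<phi> f - gr_map \<phi> g"
  by (simp add: gr_map_def frag_extend_diff)

lemma gr_map_add: "gr_map \<phi> (f + g) = gr_map \<phi> f + gr_map \<phi> g"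
  by (simp add: gr_map_def frag_extend_add)

lemma gr_map_0 [simp]: "gr_map \<phi> 0 = 0"
  by (simp add: gr_map_def)

lemma gr_map_in_Yp:
  assumes "\<And>x. x \<in> lwgroup q d \<Longrightarrow> \<phi> x \<in> lwgroup q d" "f \<in> Yp q d"
  shows "gr_map \<phi> f \<in> Yp q d"
  using assms(2) by (induction f rule: Yp_induct) (auto simp: assms(1) gr_map_diff intro: Yp_diff)

lemma gr_map_inverse:
  assumes "\<And>x. x \<in> lwgroup q d \<Longrightarrow> \<psi> (\<phi> x) = x" "f \<in> Yp q d"
  shows "gr_map \<psi> (gr_map \<phi> f) = f"
  using assms(2) by (induction f rule: Yp_induct) (auto simp: assms(1) gr_map_diff)

lemma gr_map_conv:
  assumes hom: "\<And>x y. \<lbrakk>x \<in> lwgroup q d; y \<in> lwgroup q d\<rbrakk> \<Longrightarrow> \<phi> (lwmul x y) = lwmul (\<phi> x) (\<phi> y)"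
    and "f \<in> Yp q d" "g \<in> Yp q d"
  shows "gr_map \<phi> (conv f g) = conv (gr_map \<phi> f) (gr_map \<phi> g)"
  using assms(2)
proof (induction f rule: Yp_induct)
  case (gel x)
  show ?case
    using assms(3) gel by (induction g rule: Yp_induct) (auto simp: hom gr_map_diff conv_diff_right)
qed (auto simp: gr_map_diff conv_diff_left)

lemma ring_aut_Yp_gr_map:
  assumes "\<And>x. x \<in> lwgroup q d \<Longrightarrow> \<phi> x \<in> lwgroup q d" "\<And>x. x \<in> lwgroup q d \<Longrightarrow> \<psi> x \<in> lwgroup q d"
    and "\<And>x. x \<in> lwgroup q d \<Longrightarrow> \<psi> (\<phi> x) = x" "\<And>x. x \<in> lwgroup q d \<Longrightarrow> \<phi> (\<psi> x) = x"
    and "\<And>x y. \<lbrakk>x \<in> lwgroup q d; y \<in> lwgroup q d\<rbrakk> \<Longrightarrow> \<phi> (lwmul x y) = lwmul (\<phi> x) (\<phi> y)"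
    and "\<phi> lw1 = lw1"
  shows "ring_aut_Yp q d (gr_map \<phi>)"
  unfolding ring_aut_Yp_def
proof (intro conjI ballI)
  show "bij_betw (gr_map \<phi>) (Yp q d) (Yp q d)"
    by (rule bij_betw_byWitness[where f' = "gr_map \<psi>"])
      (use assms gr_map_inverse gr_map_in_Yp in \<open>blast+\<close>)
  show "gr_map \<phi> (conv f g) = conv (gr_map \<phi> f) (gr_map \<phi> g)" if "f \<in> Yp q d" "g \<in> Yp q d" for f g
    using assms(5) that by (rule gr_map_conv)
qed (simp_all add: gr_map_add assms(6))

text \<open>Multiplicativity carries agreement from the generators to the whole group of
  l-weights.\<close>

lemma ring_aut_Yp_gel_eqI:
  assumes t: "ring_aut_Yp q d t"
    and hom: "\<And>x y. \<lbrakk>x \<in> lwgroup q d; y \<in> lwgroup q d\<rbrakk> \<Longrightarrow> \<phi> (lwmul x y) = lwmul (\<phi> x) (\<phi> y)"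
    and one: "\<phi> lw1 = lw1"
    and cw: "\<And>lam. t (gel (cw q d lam)) = gel (\<phi> (cw q d lam))"
    and Psi: "\<And>j a. a \<noteq> 0 \<Longrightarrow> t (gel (Psi j a)) = gel (\<phi> (Psi j a))"
    and x: "x \<in> lwgroup q d"
  shows "t (gel x) = gel (\<phi> x)"
  using x
proof induction
  have t_conv: "t (conv f g) = conv (t f) (t g)" if "f \<in> Yp q d" "g \<in> Yp q d" for f g
    using t that unfolding ring_aut_Yp_def by blast
  {
    case one
    then show ?case using t by (simp add: ring_aut_Yp_def \<open>\<phi> lw1 = lw1\<close>)
  next
    case (psi a i)
    then show ?case by (rule Psi)
  next
    case (psi_inv a i)
    note mem = lwgroup.psi[OF psi_inv, of i q d] lwgroup.psi_inv[OF psi_inv, of i q d]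
    have inv: "lwmul (Psi i a) (Psi_inv i a) = lw1" "lwmul (Psi_inv i a) (Psi i a) = lw1"
      using inverse_mult_eq_1[of "lin a"]
      by (auto simp: lwmul_def Psi_def Psi_inv_def lw1_def lin_def mult.commute)
    \<comment> \<open>The unknown value is a right inverse of a group element; multiplying on the
      left by the inverse of that element identifies it.\<close>
    have "conv (gel (\<phi> (Psi i a))) (t (gel (Psi_inv i a))) = gel lw1"
      using t_conv[of "gel (Psi i a)" "gel (Psi_inv i a)"] mem t psi_inv
      by (simp add: inv Psi ring_aut_Yp_def)
    then have "conv (gel (\<phi> (Psi_inv i a))) (conv (gel (\<phi> (Psi i a))) (t (gel (Psi_inv i a))))
        = gel (\<phi> (Psi_inv i a))"
      by simp
    then show ?case
      using hom[OF mem(2,1)] by (simp add: conv_gel_conv_gel inv \<open>\<phi> lw1 = lw1\<close>)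
  next
    case (cw lam)
    show ?case by (rule \<open>\<And>lam. t (gel (cw q d lam)) = gel (\<phi> (cw q d lam))\<close>)
  next
    case (mul x y)
    then show ?case
      using t_conv[of "gel x" "gel y"] hom[of x y] by simp
  }
qed


section \<open>l-weights in additive notation\<close>

lift_definition ulin :: "complex \<Rightarrow> unit_fps" is lin
  by (simp add: lin_def)

text \<open>The value at \<open>0\<close> is irrelevant; it only makes the function total.\<close>
lift_definition uconst :: "complex \<Rightarrow> unit_fps" is "\<lambda>c. fps_const (if c = 0 then 1 else c)"
  by simp

lemma rescale_ulin: "rescale c (ulin a) = ulin (a * c)"
  by transfer (simp add: lin_def fps_compose_sub_distrib fps_compose_mult_distrib fps_const_mult_apply_left
      flip: fps_const_mult)

lemma rescale_uconst [simp]: "rescale c (uconst a) = uconst a"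
  by transfer simp

definition lw :: "('i \<Rightarrow> unit_fps) \<Rightarrow> 'i lweight" where
  "lw u = (\<lambda>k. Rep_unit_fps (u k))"

text \<open>Meaningful only when all components are invertible, which \<open>lwgroup_imp_lw\<close>
  provides on \<open>lwgroup q d\<close>.\<close>

definition unlw :: "'i lweight \<Rightarrow> 'i \<Rightarrow> unit_fps" where
  "unlw x = (\<lambda>k. Abs_unit_fps (x k))"

lemma unlw_lw [simp]: "unlw (lw u) = u"
  by (simp add: unlw_def lw_def Rep_unit_fps_inverse)

lemma lw_zero: "lw (\<lambda>_. 0) = lw1"
  by (simp add: lw_def lw1_def zero_unit_fps.rep_eq)

lemma lw_add: "lw (\<lambda>k. u k + v k) = lwmul (lw u) (lw v)"
  by (simp add: lw_def lwmul_def plus_unit_fps.rep_eq)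

lemma lw_Psi: "lw (\<lambda>k. if k = i then ulin a else 0) = Psi i a"
  by (auto simp: lw_def Psi_def zero_unit_fps.rep_eq ulin.rep_eq)

lemma lw_Psi_inv: "lw (\<lambda>k. if k = i then - ulin a else 0) = Psi_inv i a"
  by (auto simp: lw_def Psi_inv_def zero_unit_fps.rep_eq ulin.rep_eq uminus_unit_fps.rep_eq)

context
  fixes q :: complex
  assumes q_nonzero: "q \<noteq> 0"
begin

interpretation act: module "act q"
  by (rule module_act[OF q_nonzero])

section \<open>Constant series\<close>

lemma uconst_powi_add: "uconst (q powi (m + n)) = uconst (q powi m) + uconst (q powi n)"
  using q_nonzero by transfer (simp add: power_int_add)

lemma uconst_powi_diff: "uconst (q powi (m - n)) = uconst (q powi m) - uconst (q powi n)"
  using uconst_powi_add[of "m - n" n] by simp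

lemma uconst_powi_uminus: "uconst (q powi (- n)) = - uconst (q powi n)"
  using uconst_powi_diff[of 0 n] uconst_powi_diff[of 0 0] by simp

lemma uconst_powi_mult: "uconst (q powi (m * n)) = ipow n (uconst (q powi m))"
proof (induction n rule: int_induct[of _ 0])
  case base
  then show ?case using uconst_powi_diff[of 0 0] by simp
next
  case (step1 n)
  then show ?case by (simp add: ipow_add uconst_powi_add distrib_left)
next
  case (step2 n)
  then show ?case by (simp add: ipow_diff uconst_powi_diff right_diff_distrib)
qed

lemma lw_cw: "lw (\<lambda>k. uconst (q powi (d k * lam k))) = cw q d lam"
  using q_nonzero by (auto simp: lw_def cw_def uconst.rep_eq)

section \<open>The group of l-weights in additive form\<close>

definition ugroup :: "('i \<Rightarrow> int) \<Rightarrow> ('i \<Rightarrow> unit_fps) set" where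
  "ugroup d = {u. lw u \<in> lwgroup q d}"

lemma ugroup_0: "(\<lambda>_. 0) \<in> ugroup d"
  by (simp add: ugroup_def lw_zero lwgroup.one)

lemma ugroup_add: "u \<in> ugroup d \<Longrightarrow> v \<in> ugroup d \<Longrightarrow> (\<lambda>k. u k + v k) \<in> ugroup d"
  by (simp add: ugroup_def lw_add lwgroup.mul)

lemma ugroup_ulin: "a \<noteq> 0 \<Longrightarrow> (\<lambda>k. if k = i then ulin a else 0) \<in> ugroup d"
  by (simp add: ugroup_def lw_Psi lwgroup.psi)

lemma ugroup_ulin_minus: "a \<noteq> 0 \<Longrightarrow> (\<lambda>k. if k = i then - ulin a else 0) \<in> ugroup d"
  by (simp add: ugroup_def lw_Psi_inv lwgroup.psi_inv)

lemma ugroup_uconst: "(\<lambda>k. uconst (q powi (d k * lam k))) \<in> ugroup d"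
  by (simp add: ugroup_def lw_cw lwgroup.cw)

lemma lwgroup_imp_lw: "x \<in> lwgroup q d \<Longrightarrow> \<exists>u. x = lw u"
proof (induction rule: lwgroup.induct)
  case (mul x y)
  then show ?case by (metis lw_add)
qed (metis lw_zero lw_Psi lw_Psi_inv lw_cw)+

lemma lw_unlw: "x \<in> lwgroup q d \<Longrightarrow> lw (unlw x) = x"
  using lwgroup_imp_lw by fastforce

lemma lwgroup_imp_ugroup: "x \<in> lwgroup q d \<Longrightarrow> unlw x \<in> ugroup d"
  by (simp add: ugroup_def lw_unlw)

lemma ugroup_induct [consumes 1, case_names zero lin lin_minus const add]:
  assumes u: "u \<in> ugroup d" and zero: "P (\<lambda>_. 0)"
    and lin: "\<And>i a. a \<noteq> 0 \<Longrightarrow> P (\<lambda>k. if k = i then ulin a else 0)"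
    and lin_minus: "\<And>i a. a \<noteq> 0 \<Longrightarrow> P (\<lambda>k. if k = i then - ulin a else 0)"
    and const: "\<And>lam. P (\<lambda>k. uconst (q powi (d k * lam k)))"
    and add: "\<And>u v. \<lbrakk>u \<in> ugroup d; v \<in> ugroup d; P u; P v\<rbrakk> \<Longrightarrow> P (\<lambda>k. u k + v k)"
  shows "P u"
proof -
  have "x \<in> lwgroup q d \<Longrightarrow> P (unlw x)" for x
  proof (induction rule: lwgroup.induct)
    case one
    then show ?case using zero by (simp flip: lw_zero)
  next
    case (psi a i)
    then show ?case using lin[of a i] by (simp flip: lw_Psi)
  next
    case (psi_inv a i)
    then show ?case using lin_minus[of a i] by (simp flip: lw_Psi_inv)
  next
    case (cw lam)
    then show ?case using const[of lam] by (simp flip: lw_cw)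
  next
    case (mul x y)
    have "lwmul x y = lw (\<lambda>k. unlw x k + unlw y k)"
      using mul.hyps by (simp add: lw_add lw_unlw)
    then show ?case
      using add[OF lwgroup_imp_ugroup[OF mul.hyps(1)] lwgroup_imp_ugroup[OF mul.hyps(2)] mul.IH] by simp
  qed
  from this[of "lw u"] show ?thesis using u by (simp add: ugroup_def)
qed

lemma ugroup_uminus: "u \<in> ugroup d \<Longrightarrow> (\<lambda>k. - u k) \<in> ugroup d"
proof (induction rule: ugroup_induct)
  case zero
  then show ?case by (simp add: ugroup_0)
next
  case (lin i a)
  have "(\<lambda>k. - (if k = i then ulin a else 0)) = (\<lambda>k. if k = i then - ulin a else 0)" by auto
  then show ?case using ugroup_ulin_minus[OF lin] by simp
next
  case (lin_minus i a)
  have "(\<lambda>k. - (if k = i then - ulin a else 0)) = (\<lambda>k. if k = i then ulin a else 0)" by auto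
  then show ?case using ugroup_ulin[OF lin_minus] by simp
next
  case (const lam)
  then show ?case
    using ugroup_uconst[of d "\<lambda>k. - lam k"] by (simp add: uconst_powi_uminus)
next
  case (add u v)
  then show ?case using ugroup_add[OF add.IH] by (simp add: algebra_simps)
qed

lemma ugroup_diff: "u \<in> ugroup d \<Longrightarrow> v \<in> ugroup d \<Longrightarrow> (\<lambda>k. u k - v k) \<in> ugroup d"
  using ugroup_add[OF _ ugroup_uminus, of u d v] by simp

text \<open>A power of t turns \<open>ulin a\<close> into \<open>ulin (a * q powi n)\<close>, again
  a generator because \<open>q \<noteq> 0\<close>; additivity in \<open>F\<close> does the
  rest.\<close>

lemma ugroup_act_ulin:
  assumes "a \<noteq> 0"
  shows "(\<lambda>k. if k = i then act q F (ulin a) else 0) \<in> ugroup d"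
proof (induction F rule: frag_induction[OF subset_UNIV])
  case 1
  have "(\<lambda>k. if k = i then act q 0 (ulin a) else 0) = (\<lambda>_. 0)" by auto
  then show ?case by (simp add: ugroup_0)
next
  case (2 n)
  then show ?case using ugroup_ulin[of "a * q powi n"] assms q_nonzero by (simp add: rescale_ulin cong: if_cong)
next
  case (3 F G)
  have "(\<lambda>k. if k = i then act q (F - G) (ulin a) else 0)
     = (\<lambda>k. (if k = i then act q F (ulin a) else 0) - (if k = i then act q G (ulin a) else 0))"
    by (auto simp: act_diff_left)
  then show ?case using ugroup_diff[OF 3] by simp
qed

lemma ugroup_componentwise:
  fixes u :: "'i::finite \<Rightarrow> unit_fps"
  assumes "\<And>j. (\<lambda>k. if k = j then u j else 0) \<in> ugroup d"
  shows "u \<in> ugroup d"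
proof -
  have "(\<lambda>k. if k \<in> S then u k else 0) \<in> ugroup d" for S :: "'i set"
    using finite[of S]
  proof (induction S rule: finite_induct)
    case empty
    then show ?case by (simp add: ugroup_0)
  next
    case (insert j S)
    have "(\<lambda>k. if k \<in> insert j S then u k else 0)
        = (\<lambda>k. (if k = j then u j else 0) + (if k \<in> S then u k else 0))"
      using insert.hyps by auto
    then show ?case using ugroup_add[OF assms insert.IH] by simp
  qed
  from this[of UNIV] show ?thesis by simp
qed

lemma transvect_act_add:
  "transvect (act q) P i (\<lambda>k. u k + v k) = (\<lambda>k. transvect (act q) P i u k + transvect (act q) P i v k)"
  by (auto simp: transvect_def act_add_right)

text \<open>Constants enter as a hypothesis: an element of the group has a power of
  \<open>q powi d k\<close> as constant term at \<open>k\<close>, while the transvection multiplies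
  it by powers of \<open>q powi d i\<close>. Linear factors at \<open>i\<close> are handled one
  target component at a time.\<close>

lemma transvect_act_ugroup:
  fixes d :: "'i::finite \<Rightarrow> int"
  assumes const: "\<And>lam. transvect (act q) P i (\<lambda>k. uconst (q powi (d k * lam k))) \<in> ugroup d"
    and u: "u \<in> ugroup d"
  shows "transvect (act q) P i u \<in> ugroup d"
proof -
  have lin: "transvect (act q) P i (\<lambda>k. if k = j then ulin a else 0) \<in> ugroup d" if "a \<noteq> 0" for j a
  proof (cases "j = i")
    case True
    have "(\<lambda>k. act q (P i k) (ulin a)) \<in> ugroup d"
      by (rule ugroup_componentwise) (use that in \<open>simp add: ugroup_act_ulin\<close>)
    from ugroup_add[OF ugroup_ulin[OF that] this] show ?thesis
      by (simp add: transvect_def True)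
  next
    case False
    then show ?thesis using ugroup_ulin[OF that] by (simp add: transvect_def)
  qed
  show ?thesis using u
  proof (induction rule: ugroup_induct)
    case zero
    then show ?case by (simp add: transvect_def ugroup_0)
  next
    case (lin_minus j a)
    have "transvect (act q) P i (\<lambda>k. if k = j then - ulin a else 0)
        = (\<lambda>k. - transvect (act q) P i (\<lambda>k. if k = j then ulin a else 0) k)"
      by (auto simp: transvect_def)
    then show ?case using ugroup_uminus[OF lin[OF lin_minus]] by simp
  next
    case (add u v)
    then show ?case by (simp add: transvect_act_add ugroup_add)
  qed (use lin const in auto)
qed

end


section \<open>The braid group action\<close>

text \<open>The matrix of \<open>T'\<^sub>i\<close> over Laurent polynomials, with \<open>frag_of n\<close> in the role of \<open>t\<^sup>n\<close>.\<close>
definition tmat :: "('i \<Rightarrow> 'i \<Rightarrow> int) \<Rightarrow> ('i \<Rightarrow> int) \<Rightarrow> 'i \<Rightarrow> 'i \<Rightarrow> (int \<Rightarrow>\<^sub>0 int)" where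
  "tmat C d i k =
     (if k = i then - 1 - frag_of (2 * d i)
      else if C i k = -1 then frag_of (d i)
      else if C i k = -2 then frag_of 0 + frag_of 2
      else if C i k = -3 then frag_of (-1) + frag_of 1 + frag_of 3
      else 0)"

lemma alt_transfer:
  assumes "R x y" "\<And>x y. R x y \<Longrightarrow> R (f x) (f' y)" "\<And>x y. R x y \<Longrightarrow> R (g x) (g' y)"
  shows "R (alt f g n x) (alt f' g' n y)"
  using assms(2,3)
proof (induction n arbitrary: f g f' g')
  case 0
  then show ?case using assms(1) by simp
next
  case (Suc n)
  then show ?case by simp
qed

context
  fixes C :: "'i::finite \<Rightarrow> 'i \<Rightarrow> int" and d :: "'i \<Rightarrow> int" and q :: complex
  assumes cartan: "cartan_simple C d" and q_nonzero: "q \<noteq> 0"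
begin

interpretation act: module "act q"
  by (rule module_act[OF q_nonzero])

text \<open>Fixing the values of \<open>d\<close> on multiple edges reconciles the plain powers of
  \<open>q\<close> in \<open>TPsi_rhs\<close> and \<open>Aexp\<close> with the powers of
  \<open>q powi d i\<close>.\<close>

lemma cartan_cases_normalised:
  assumes "i \<noteq> j"
  obtains "C i j = 0" "C j i = 0"
  | "C i j = -1" "C j i = -1" "d i = d j"
  | "C i j = -2" "C j i = -1" "d i = 1" "d j = 2"
  | "C i j = -3" "C j i = -1" "d i = 1" "d j = 3"
  | "C i j = -1" "C j i = -2" "d i = 2" "d j = 1"
  | "C i j = -1" "C j i = -3" "d i = 3" "d j = 1"
  using cartan_cases[OF cartan assms] cartan_multiple_edge_d[OF cartan, of i j]
    cartan_multiple_edge_d[OF cartan, of j i] by (smt (verit, best))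

text \<open>The product of the two off-diagonal entries is \<open>t^(d i) * t^(d j)\<close> for A2,
  \<open>(1 + t^2) * t^2\<close> for B2 and \<open>(t^-1 + t + t^3) * t^3\<close> for G2; in the
  last two \<open>a = t^2\<close> belongs to the vertex with \<open>d = 1\<close>.\<close>

lemma tmat_braid:
  assumes "i \<noteq> j"
  shows "alt (transvect (act q) (tmat C d) i) (transvect (act q) (tmat C d) j) (braid_m C i j) u
       = alt (transvect (act q) (tmat C d) j) (transvect (act q) (tmat C d) i) (braid_m C i j) u"
proof -
  show ?thesis
    using assms
  proof (cases rule: cartan_cases_normalised)
    case 1
    then show ?thesis
      using act.transvect_braid_A1A1[where P = "tmat C d" and i = i and j = j
          and a = "frag_of (2 * d i)" and b = "frag_of (2 * d j)" and x = u] assms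
      by (simp add: braid_m_def tmat_def)
  next
    case 2
    then show ?thesis
      using act.transvect_braid_A2[where P = "tmat C d" and i = i and j = j and a = "frag_of (2 * d i)" and x = u] assms
      by (simp add: braid_m_def tmat_def mult_single algebra_simps)
  next
    case 3
    then show ?thesis
      using act.transvect_braid_B2[where P = "tmat C d" and i = i and j = j and a = "frag_of 2" and x = u] assms
      by (simp add: braid_m_def tmat_def mult_single algebra_simps)
  next
    case 4
    then show ?thesis
      using act.transvect_braid_G2[where P = "tmat C d" and i = i and j = j and a = "frag_of 2" and x = u] assms
      by (simp add: braid_m_def tmat_def mult_single algebra_simps)
  next
    \<comment> \<open>Here \<open>j\<close> is the vertex with \<open>d = 1\<close>, so the roles
      are exchanged.\<close>
    case 5
    then show ?thesis
      using act.transvect_braid_B2[where P = "tmat C d" and i = j and j = i and a = "frag_of 2" and x = u] assms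
      by (simp add: braid_m_def tmat_def mult_single algebra_simps)
  next
    case 6
    then show ?thesis
      using act.transvect_braid_G2[where P = "tmat C d" and i = j and j = i and a = "frag_of 2" and x = u] assms
      by (simp add: braid_m_def tmat_def mult_single algebra_simps)
  qed
qed

section \<open>The operators on l-weights\<close>

definition reflw :: "'i \<Rightarrow> 'i lweight \<Rightarrow> 'i lweight" where
  "reflw i x = lw (transvect (act q) (tmat C d) i (unlw x))"

text \<open>The extra factor is the inverse of the \<open>a\<close> in
  \<open>tmat C d i i = - 1 - a\<close>, as in \<open>transvect_inverse\<close>.\<close>

definition reflw_inv :: "'i \<Rightarrow> 'i lweight \<Rightarrow> 'i lweight" where
  "reflw_inv i x = lw (transvect (act q) (\<lambda>i k. frag_of (- 2 * d i) * tmat C d i k) i (unlw x))"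

text \<open>Substitutions fix constants, so a Laurent polynomial acts through its value at t = 1,
  here \<open>- C i k\<close>; the symmetry \<open>d i * C i k = d k * C k i\<close> turns the
  result into a power of \<open>q powi d k\<close>.\<close>

lemma transvect_tmat_uconst:
  "transvect (act q) (tmat C d) i (\<lambda>k. uconst (q powi (d k * lam k)))
     = (\<lambda>k. uconst (q powi (d k * srefl C i lam k)))"
proof
  fix k
  let ?c = "uconst (q powi (d i * lam i))"
  have c2: "?c + ?c = uconst (q powi (2 * (d i * lam i)))"
    and c3: "?c + ?c + ?c = uconst (q powi (3 * (d i * lam i)))"
    by (simp_all add: uconst_powi_add[OF q_nonzero, symmetric])
  show "transvect (act q) (tmat C d) i (\<lambda>k. uconst (q powi (d k * lam k))) k
      = uconst (q powi (d k * srefl C i lam k))"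
  proof (cases "i = k")
    case True
    have "d k * srefl C i lam k = d k * lam k - (d k * lam k + d k * lam k)"
      using True cartan_diag[OF cartan, of k] by (simp add: srefl_def algebra_simps)
    then show ?thesis
      using True
      by (simp add: transvect_def tmat_def act_diff_left act_minus_left uconst_powi_uminus[OF q_nonzero])
  next
    case False
    then show ?thesis
    proof (cases rule: cartan_cases_normalised)
      case 3
      then show ?thesis using False
        by (simp add: transvect_def tmat_def act_add_left srefl_def c2
            uconst_powi_add[OF q_nonzero, symmetric] algebra_simps)
    next
      case 4
      then show ?thesis using False
        by (simp add: transvect_def tmat_def act_add_left srefl_def c3
            uconst_powi_add[OF q_nonzero, symmetric] algebra_simps)
    qed (use False in \<open>simp_all add: transvect_def tmat_def srefl_def
          uconst_powi_add[OF q_nonzero, symmetric] algebra_simps\<close>)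
  qed
qed

text \<open>The additional power of t acts trivially on constants.\<close>

lemma transvect_tmat_inv_uconst:
  "transvect (act q) (\<lambda>i k. frag_of (- 2 * d i) * tmat C d i k) i (\<lambda>k. uconst (q powi (d k * lam k)))
     = (\<lambda>k. uconst (q powi (d k * srefl C i lam k)))"
  unfolding transvect_tmat_uconst[symmetric]
  by (simp add: transvect_def mult.commute[of "frag_of _"] act_mult[OF q_nonzero])

lemma reflw_lwgroup: "x \<in> lwgroup q d \<Longrightarrow> reflw i x \<in> lwgroup q d"
  using transvect_act_ugroup[OF q_nonzero _ lwgroup_imp_ugroup[OF q_nonzero], of "tmat C d" i d x]
  by (simp add: transvect_tmat_uconst lw_cw[OF q_nonzero] lwgroup.cw reflw_def ugroup_def[OF q_nonzero])

lemma reflw_inv_lwgroup: "x \<in> lwgroup q d \<Longrightarrow> reflw_inv i x \<in> lwgroup q d"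
  using transvect_act_ugroup[OF q_nonzero _ lwgroup_imp_ugroup[OF q_nonzero],
      of "\<lambda>i k. frag_of (- 2 * d i) * tmat C d i k" i d x]
    transvect_tmat_inv_uconst
  by (simp add: lw_cw[OF q_nonzero] lwgroup.cw reflw_inv_def ugroup_def[OF q_nonzero])

lemma reflw_reflw_inv:
  assumes "x \<in> lwgroup q d"
  shows "reflw i (reflw_inv i x) = x" "reflw_inv i (reflw i x) = x"
proof -
  have "frag_of (2 * d i) * frag_of (- 2 * d i) = (1 :: int \<Rightarrow>\<^sub>0 int)" by (simp add: mult_single)
  moreover have "tmat C d i i = - 1 - frag_of (2 * d i)" by (simp add: tmat_def)
  ultimately show "reflw i (reflw_inv i x) = x" "reflw_inv i (reflw i x) = x"
    using act.transvect_inverse[of "tmat C d" i "frag_of (2 * d i)" "frag_of (- 2 * d i)"]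
    by (simp_all add: reflw_def reflw_inv_def lw_unlw[OF q_nonzero assms] transvect_def)
qed

lemma reflw_lwmul:
  assumes "x \<in> lwgroup q d" "y \<in> lwgroup q d"
  shows "reflw i (lwmul x y) = lwmul (reflw i x) (reflw i y)"
proof -
  have "lwmul x y = lw (\<lambda>k. unlw x k + unlw y k)"
    using assms by (simp add: lw_add lw_unlw[OF q_nonzero])
  then show ?thesis
    by (simp add: reflw_def transvect_act_add[OF q_nonzero] flip: lw_add)
qed

lemma reflw_lw1: "reflw i lw1 = lw1"
  by (simp add: reflw_def transvect_def flip: lw_zero)

lemma reflw_cw: "reflw i (cw q d lam) = cw q d (srefl C i lam)"
  by (simp add: reflw_def transvect_tmat_uconst flip: lw_cw[OF q_nonzero])

lemma reflw_Psi_other: "j \<noteq> i \<Longrightarrow> reflw i (Psi j a) = Psi j a"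
  by (simp add: reflw_def transvect_def flip: lw_Psi)

lemma reflw_Psi_same: "reflw i (Psi i a) = TPsi_rhs q C d i a"
proof -
  have sq: "q powi (2 * d i) = (q powi d i)\<^sup>2"
    by (simp add: power_int_mult mult.commute[of 2])
  have eq: "transvect (act q) (tmat C d) i (\<lambda>k. if k = i then ulin a else 0)
     = (\<lambda>k. if k = i then - ulin (a * (q powi d i)\<^sup>2)
     else if C i k = -1 then ulin (a * q powi d i)
     else if C i k = -2 then ulin a + ulin (a * q\<^sup>2)
     else if C i k = -3 then ulin (a * inverse q) + ulin (a * q) + ulin (a * q ^ 3)
     else 0)"
    by (auto simp: transvect_def tmat_def act_diff_left act_minus_left act_add_left rescale_ulin sq)
  show ?thesis
    unfolding reflw_def lw_Psi[symmetric] unlw_lw eq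
    by (auto simp: TPsi_rhs_def lw_def ulin.rep_eq uminus_unit_fps.rep_eq
        plus_unit_fps.rep_eq zero_unit_fps.rep_eq)
qed

section \<open>Existence and uniqueness of the operators, and the braid relations\<close>

lemma is_Tprime_gr_map_reflw: "is_Tprime q C d i (gr_map (reflw i))"
  unfolding is_Tprime_def
proof (intro conjI allI impI)
  show "ring_aut_Yp q d (gr_map (reflw i))"
    by (rule ring_aut_Yp_gr_map[where \<psi> = "reflw_inv i"])
      (simp_all add: reflw_lwgroup reflw_inv_lwgroup reflw_reflw_inv reflw_lwmul reflw_lw1)
qed (simp_all add: reflw_cw reflw_Psi_other reflw_Psi_same)

lemma is_Tprime_gel:
  assumes t: "is_Tprime q C d i t" and x: "x \<in> lwgroup q d"
  shows "t (gel x) = gel (reflw i x)"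
proof (rule ring_aut_Yp_gel_eqI[OF _ reflw_lwmul reflw_lw1 _ _ x])
  show "t (gel (Psi j a)) = gel (reflw i (Psi j a))" if "a \<noteq> 0" for j a
    using t that unfolding is_Tprime_def by (cases "j = i") (simp_all add: reflw_Psi_other reflw_Psi_same)
qed (use t in \<open>simp_all add: is_Tprime_def reflw_cw\<close>)

lemma Tprime_braid:
  assumes T: "\<And>i. is_Tprime q C d i (T i)" and "i \<noteq> j" "f \<in> Yp q d"
  shows "alt (T i) (T j) (braid_m C i j) f = alt (T j) (T i) (braid_m C i j) f"
proof (rule additive_on_Yp_eqI[OF _ _ _ assms(3)])
  have add: "additive_on_Yp q d (T i)" for i
    using T[of i] by (simp add: is_Tprime_def ring_aut_Yp_additive)
  show "additive_on_Yp q d (alt (T i) (T j) (braid_m C i j))"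
    "additive_on_Yp q d (alt (T j) (T i) (braid_m C i j))"
    by (intro additive_on_Yp_alt add)+
  fix x assume x: "x \<in> lwgroup q d"
  \<comment> \<open>\<open>R\<close> follows a word in the operators alongside the same word in the
    transvections; membership in \<open>lwgroup\<close> keeps \<open>is_Tprime_gel\<close>
    applicable at each letter.\<close>
  define R where "R g u \<longleftrightarrow> g = gel (lw u) \<and> lw u \<in> lwgroup q d" for g u
  have step: "R (T i g) (transvect (act q) (tmat C d) i u)" if "R g u" for i g u
    using that is_Tprime_gel[OF T, of "lw u" i] reflw_lwgroup[of "lw u" i]
    by (simp add: R_def reflw_def)
  have "R (gel x) (unlw x)" using x by (simp add: R_def lw_unlw[OF q_nonzero])
  then have "R (alt (T i) (T j) n (gel x))
      (alt (transvect (act q) (tmat C d) i) (transvect (act q) (tmat C d) j) n (unlw x))" for i j n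
    by (rule alt_transfer[where R = R]) (rule step, assumption)+
  then show "alt (T i) (T j) (braid_m C i j) (gel x) = alt (T j) (T i) (braid_m C i j) (gel x)"
    using tmat_braid[OF assms(2), of "unlw x"] unfolding R_def by metis
qed

section \<open>Comparison with the Chari operators\<close>

text \<open>The component of \<open>Y\<^sub>j\<^sub>,\<^sub>a\<close> at \<open>j\<close> when \<open>d j = n\<close>.\<close>
definition uY :: "int \<Rightarrow> complex \<Rightarrow> unit_fps" where
  "uY n a = uconst (q powi n) + ulin (a * inverse (q powi n)) - ulin (a * q powi n)"

lemma rescale_uY: "rescale c (uY n a) = uY n (a * c)"
  by (simp add: uY_def rescale_add rescale_diff rescale_ulin ac_simps)

text \<open>The linear factors telescope, as they do in \<open>uY_3\<close>.\<close>

lemma uY_2: "uY 2 a = uY 1 (a * inverse q) + uY 1 (a * q)"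
  using uconst_powi_add[OF q_nonzero, of 1 1] q_nonzero
  by (simp add: uY_def power2_eq_square mult.assoc)

lemma uY_3: "uY 3 a = uY 1 (a * inverse (q\<^sup>2)) + uY 1 a + uY 1 (a * q\<^sup>2)"
proof -
  have c: "uconst (q ^ 3) = uconst q + uconst q + uconst q"
    using uconst_powi_add[OF q_nonzero, of 2 1] uconst_powi_add[OF q_nonzero, of 1 1] by simp
  have e: "a * inverse (q\<^sup>2) * q = a * inverse q" "a * q\<^sup>2 * inverse q = a * q"
    "a * inverse (q\<^sup>2) * inverse q = a * inverse (q ^ 3)" "a * q\<^sup>2 * q = a * q ^ 3"
    using q_nonzero by (simp_all add: power2_eq_square power3_eq_cube)
  show ?thesis
    unfolding uY_def power_int_numeral power_int_1_right e c by simp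
qed

definition uY_at :: "'i \<Rightarrow> 'i \<times> complex \<Rightarrow> unit_fps" where
  "uY_at k p = (if fst p = k then uY (d k) (snd p) else 0)"

lemma ywt_eq_lw: "ywt q d m = lw (\<lambda>k. lincomb (uY_at k) m)"
proof
  fix k
  let ?S = "{p \<in> Poly_Mapping.keys m. fst p = k}"
  let ?l = "Poly_Mapping.lookup m"
  let ?v = "\<lambda>p. ulin (snd p * inverse (q powi d k)) + - ulin (snd p * q powi d k)"
  have "lincomb (uY_at k) m = (\<Sum>p\<in>?S. ipow (?l p) (uY_at k p))"
    unfolding lincomb_def by (rule sum.mono_neutral_right) (auto simp: uY_at_def)
  also have "\<dots> = (\<Sum>p\<in>?S. ipow (?l p) (uconst (q powi d k)) + ipow (?l p) (?v p))"
    by (intro sum.cong refl) (auto simp: uY_at_def uY_def add_diff_eq simp flip: ipow_plus)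
  also have "\<dots> = ipow (\<Sum>p\<in>?S. ?l p) (uconst (q powi d k)) + (\<Sum>p\<in>?S. ipow (?l p) (?v p))"
    by (simp add: sum.distrib ipow_sum)
  also have "\<dots> = uconst (q powi (d k * (\<Sum>p\<in>?S. ?l p))) + (\<Sum>p\<in>?S. ipow (?l p) (?v p))"
    by (simp add: uconst_powi_mult[OF q_nonzero])
  finally show "ywt q d m k = lw (\<lambda>k. lincomb (uY_at k) m) k"
    using q_nonzero
    by (simp add: ywt_def lw_def plus_unit_fps.rep_eq uconst.rep_eq Rep_unit_fps_sum ipow.rep_eq
        ulin.rep_eq Rep_unit_fps_diff)
qed

text \<open>Ensures that \<open>iota\<close> takes values in \<open>Yp\<close>.\<close>

lemma lincomb_uY_at_ugroup:
  assumes "\<And>p. p \<in> Poly_Mapping.keys m \<Longrightarrow> snd p \<noteq> 0"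
  shows "(\<lambda>k. lincomb (uY_at k) m) \<in> ugroup q d"
proof -
  have "Poly_Mapping.keys m \<subseteq> {p. snd p \<noteq> 0}" using assms by auto
  then show ?thesis
  proof (induction m rule: frag_induction)
    case zero
    then show ?case by (simp add: ugroup_0[OF q_nonzero])
  next
    case (one p)
    let ?e = "\<lambda>c k. if k = fst p then ulin c else 0"
    have ne: "snd p * inverse (q powi d (fst p)) \<noteq> 0" "snd p * q powi d (fst p) \<noteq> 0"
      using one q_nonzero by auto
    have "(\<lambda>k. lincomb (uY_at k) (frag_of p))
        = (\<lambda>k. (uconst (q powi (d k * (if k = fst p then 1 else 0)))
            + ?e (snd p * inverse (q powi d (fst p))) k) - ?e (snd p * q powi d (fst p)) k)"
      using uconst_powi_diff[OF q_nonzero, of 0 0] by (auto simp: uY_at_def uY_def)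
    then show ?case
      using ugroup_diff[OF q_nonzero ugroup_add[OF q_nonzero
          ugroup_uconst[OF q_nonzero, of d "\<lambda>k. if k = fst p then 1 else 0"]
          ugroup_ulin[OF q_nonzero ne(1), of "fst p"]] ugroup_ulin[OF q_nonzero ne(2), of "fst p"]]
      by simp
  next
    case (diff m m')
    then show ?case by (simp add: lincomb_diff ugroup_diff[OF q_nonzero])
  qed
qed

text \<open>Shows that \<open>Tmon\<close> is additive in the exponent vector.\<close>

lemma Tmon_eq:
  "Tmon q C d i m = m - frag_extend (\<lambda>p. if fst p = i then Aexp q C d i (snd p * q powi d i) else 0) m"
  unfolding Tmon_def frag_extend_def by (auto intro: sum.cong)

lemma lincomb_uY_at_Aexp:
  "lincomb (uY_at k) (Aexp q C d i b) =
     (if k = i then uY (d i) (b * inverse (q powi d i)) + uY (d i) (b * q powi d i)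
      else - (if C k i = -1 then uY (d k) b
              else if C k i = -2 then uY (d k) (b * inverse q) + uY (d k) (b * q)
              else if C k i = -3 then uY (d k) (b * inverse (q\<^sup>2)) + uY (d k) b + uY (d k) (b * q\<^sup>2)
              else 0))"
proof -
  have pick: "(\<Sum>j\<in>{j. C j i = c}. if j = k then g j else 0) = (if C k i = c then g k else 0)"
    for c and g :: "'i \<Rightarrow> unit_fps"
    by (simp add: sum.delta)
  show ?thesis
    using cartan_diag[OF cartan, of i]
    by (simp add: Aexp_def Yv_def lincomb_diff lincomb_add lincomb_sum uY_at_def sum.distrib pick)
qed

text \<open>Both sides are additive in \<open>m\<close>, so a single variable suffices, and those
  with \<open>j \<noteq> i\<close> are fixed.\<close>

lemma transvect_tmat_lincomb:
  "transvect (act q) (tmat C d) i (\<lambda>k. lincomb (uY_at k) m) = (\<lambda>k. lincomb (uY_at k) (Tmon q C d i m))"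
proof (induction m rule: frag_induction[OF subset_UNIV])
  case 1
  show ?case by (simp add: transvect_def Tmon_eq)
next
  case (2 p)
  obtain j a where p: "p = (j, a)" by (cases p)
  show ?case
  proof (cases "j = i")
    case False
    then show ?thesis by (simp add: p transvect_def Tmon_eq uY_at_def)
  next
    case True
    show ?thesis
    proof
      fix k
      have 1: "transvect (act q) (tmat C d) i (\<lambda>k. lincomb (uY_at k) (frag_of p)) k
          = uY_at k (i, a) + act q (tmat C d i k) (uY (d i) a)"
        by (simp add: transvect_def p True uY_at_def)
      have 2: "lincomb (uY_at k) (Tmon q C d i (frag_of p))
          = uY_at k (i, a) - lincomb (uY_at k) (Aexp q C d i (a * q powi d i))"
        by (simp add: Tmon_eq lincomb_diff p True)
      \<comment> \<open>The left side is governed by \<open>C i k\<close>, the right by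
        \<open>C k i\<close>. On a multiple edge the two have different numbers of terms, and
        \<open>uY_2\<close> and \<open>uY_3\<close> split the component with the larger
        \<open>d\<close> to match them.\<close>
      have 3: "act q (tmat C d i k) (uY (d i) a) = - lincomb (uY_at k) (Aexp q C d i (a * q powi d i))"
      proof (cases "i = k")
        case True
        have "q powi (2 * d i) = q powi d i * q powi d i"
          using q_nonzero by (simp flip: power_int_add)
        then show ?thesis
          using True q_nonzero
          by (simp add: lincomb_uY_at_Aexp tmat_def act_diff_left act_minus_left rescale_uY mult.assoc)
      next
        case False
        note simps = lincomb_uY_at_Aexp tmat_def act_add_left rescale_uY
        from False show ?thesis
        proof (cases rule: cartan_cases_normalised)
          case 3
          have e: "a * q * inverse q = a" "a * q * q = a * q\<^sup>2"
            using q_nonzero by (simp_all add: power2_eq_square)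
          from 3 False show ?thesis by (simp add: simps uY_2 e)
        next
          case 4
          have e: "a * q * inverse (q\<^sup>2) = a * inverse q" "a * q * q\<^sup>2 = a * q ^ 3"
            using q_nonzero by (simp_all add: power2_eq_square power3_eq_cube)
          from 4 False show ?thesis by (simp add: simps uY_3 e)
        next
          case 5
          with False show ?thesis using uY_2[of "a * q\<^sup>2"] by (simp add: simps)
        next
          case 6
          with False show ?thesis using uY_3[of "a * q ^ 3"] by (simp add: simps)
        qed (use False in \<open>simp_all add: simps\<close>)
      qed
      show "transvect (act q) (tmat C d) i (\<lambda>k. lincomb (uY_at k) (frag_of p)) k
          = lincomb (uY_at k) (Tmon q C d i (frag_of p))"
        unfolding 1 2 3 by simp
    qed
  qed
next
  case (3 m m')
  have "Tmon q C d i (m - m') = Tmon q C d i m - Tmon q C d i m'"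
    by (simp add: Tmon_eq frag_extend_diff)
  moreover have "transvect (act q) (tmat C d) i (\<lambda>k. lincomb (uY_at k) (m - m'))
      = (\<lambda>k. transvect (act q) (tmat C d) i (\<lambda>k. lincomb (uY_at k) m) k
          - transvect (act q) (tmat C d) i (\<lambda>k. lincomb (uY_at k) m') k)"
    by (auto simp: transvect_def lincomb_diff act_diff_right)
  ultimately show ?case by (simp add: 3 lincomb_diff)
qed

lemma Tprime_iota:
  assumes T: "is_Tprime q C d i t" and "f \<in> Ycar"
  shows "t (iota q d f) = iota q d (Tchari q C d i f)"
proof -
  have iota: "iota q d g = frag_extend (\<lambda>m. gel (ywt q d m)) g" for g
    by (simp add: iota_def frag_extend_def gel_def frag_cmul_single)
  have Tch: "Tchari q C d i g = frag_extend (\<lambda>m. frag_of (Tmon q C d i m)) g" for g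
    by (simp add: Tchari_def frag_extend_def frag_cmul_single)
  have add: "additive_on_Yp q d t"
    using T by (simp add: is_Tprime_def ring_aut_Yp_additive)
  have t0: "t 0 = 0"
    using add unfolding additive_on_Yp_def by (metis Yp_0 diff_self)
  have "Poly_Mapping.keys f \<subseteq> {m. \<forall>p\<in>Poly_Mapping.keys m. snd p \<noteq> 0}"
    using assms(2) by (auto simp: Ycar_def)
  \<comment> \<open>Membership in \<open>Yp\<close> is carried along because \<open>t\<close> is
    additive there.\<close>
  then have "iota q d f \<in> Yp q d \<and> t (iota q d f) = iota q d (Tchari q C d i f)"
  proof (induction f rule: frag_induction)
    case zero
    then show ?case by (simp add: iota Tch t0)
  next
    case (one m)
    then have "ywt q d m \<in> lwgroup q d"
      using lincomb_uY_at_ugroup[of m] by (simp add: ywt_eq_lw ugroup_def[OF q_nonzero])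
    then show ?case
      using is_Tprime_gel[OF T, of "ywt q d m"]
      by (simp add: iota Tch reflw_def ywt_eq_lw transvect_tmat_lincomb)
  next
    case (diff f g)
    then show ?case
      using add by (simp add: iota Tch frag_extend_diff Yp_diff additive_on_Yp_def)
  qed
  then show ?thesis ..
qed

end

theorem mainTheorem3:
  fixes C :: "'i::finite \<Rightarrow> 'i \<Rightarrow> int" and d :: "'i \<Rightarrow> int" and q :: complex
  assumes "cartan_simple C d"
    and "q \<noteq> 0"
    and "\<forall>n::nat. n > 0 \<longrightarrow> q ^ n \<noteq> 1"
  shows "(\<forall>i. \<exists>t. is_Tprime q C d i t) \<and>
         (\<forall>T. (\<forall>i. is_Tprime q C d i (T i)) \<longrightarrow>
            (\<forall>i j. i \<noteq> j \<longrightarrow> (\<forall>f\<in>Yp q d.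
               alt (T i) (T j) (braid_m C i j) f = alt (T j) (T i) (braid_m C i j) f)) \<and>
            (\<forall>i. \<forall>f\<in>Ycar. T i (iota q d f) = iota q d (Tchari q C d i f)))"
proof (intro conjI allI impI ballI)
  show "\<exists>t. is_Tprime q C d i t" for i
    by (rule exI) (rule is_Tprime_gr_map_reflw[OF assms(1,2)])
next
  fix T and i j :: 'i and f
  assume "\<forall>i. is_Tprime q C d i (T i)" "i \<noteq> j" "f \<in> Yp q d"
  then show "alt (T i) (T j) (braid_m C i j) f = alt (T j) (T i) (braid_m C i j) f"
    by (intro Tprime_braid[OF assms(1,2)]) simp_all
next
  fix T and i :: 'i and f
  assume "\<forall>i. is_Tprime q C d i (T i)" "f \<in> (Ycar :: ('i ymon \<Rightarrow>\<^sub>0 int) set)"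
  then show "T i (iota q d f) = iota q d (Tchari q C d i f)"
    by (intro Tprime_iota[OF assms(1,2)]) simp_all
qed

end
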